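(* For every $\chi^+,\chi^-\in\mathbb C((z))$ with $\chi^\pm\neq0$, $F(\chi^+,\chi^-):=F\otimes M(\chi^+,\chi^-)$ is an irreducible $V^{cri}(\mathfrak{gl}(1|1))$-module.
   Context: All vector spaces are over $\mathbb C$; "vertex algebra" includes vertex superalgebras, and brackets are supercommutators. **The affine vertex algebra.** Let $\mathfrak g=\mathfrak{gl}(1|1)$ with standard basis $E_{i,j}$, $i,j\in\{1,2\}$, where $\bar 1=\bar 0$, $\bar 2=\bar 1\in\mathbb Z_2$ (index $1$ even, index $2$ odd). The affine Lie superalgebra is $\widehat{\mathfrak g}=\mathfrak g\otimes\mathbb C[t,t^{-1}]+\mathbb C K$, with $K$ even and central, $x(r)=x\otimes t^r$, and $$[E_{i,j}(r),E_{k,\ell}(s)]=\delta_{k,j}E_{i,\ell}(r+s)-\delta_{i,\ell}E_{k,j}(r+s)(-1)^{(\bar i+\bar j)(\bar k+\bar\ell)}+K\,\delta_{i,j}\delta_{k,\ell}(-1)^{\bar i+\bar k}\,r\,\delta_{r+s,0}.$$ Let $\mathbb C v$ be the one-dimensional module over $P=\mathfrak g\otimes\mathbb C[t]+\mathbb C K$ with $Kv=v$, $(\mathfrak g\otimes\mathbb C[t])v=0$. Then $V^{cri}(\mathfrak g)=U(\widehat{\mathfrak g})\otimes_{U(P)}\mathbb C v$, a vertex algebra with vacuum $1\otimes v$ generated by the fields $E_{i,j}(z)=\sum_{r\in\mathbb Z}E_{i,j}(r)z^{-r-1}$. **Fermions.** $F$ is the Clifford vertex algebra generated by the odd fields $\Psi^\pm(z)=\sum_{m\in\mathbb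 Z}\Psi^\pm(m+\tfrac12)z^{-m-1}$ with $\{\Psi^+(r),\Psi^-(s)\}=\delta_{r+s,0}$, $\{\Psi^\pm(r),\Psi^\pm(s)\}=0$ for $r,s\in\tfrac12+\mathbb Z$; it is the irreducible module over the corresponding Clifford algebra generated by $\mathbf 1$ with $\Psi^\pm(r)\mathbf 1=0$ for $r>0$. Put $\alpha=\Psi^+(-\tfrac12)\Psi^-(-\tfrac12)\mathbf 1$, with field $\alpha(z)={:}\Psi^+(z)\Psi^-(z){:}$. **$M$ and its one-dimensional modules.** $M=\mathbb C[a^+(m+\tfrac12),a^-(m+\tfrac12)\mid m\in\mathbb Z_{<0}]$ is the commutative vertex algebra generated by the fields $a^\pm(z)=\sum_{m<0}a^\pm(m+\tfrac12)z^{-m-1}$. For $\chi^\pm(z)=\sum_{n\in\mathbb Z}\chi^\pm_n z^{-n-1}\in\mathbb C((z))$, $M(\chi^+,\chi^-)$ denotes the one-dimensional irreducible $M$-module on which the field $a^\pm(z)$ acts as multiplication by $\chi^\pm(z)$ (the coefficient of $z^{-n-1}$ of $a^\pm(z)$ acts as $\chi^\pm_n$). **Module structure.** $F\otimes M(\chi^+,\chi^-)$ is an $F\otimes M$-module, hence a $V^{cri}(\mathfrak{gl}(1|1))$-module through the vertex algebra homomorphism $V^{cri}(\mathfrak{gl}(1|1))\to F\otimes M$ given by $E_{1,1}\mapsto\alpha$, $E_{1,2}\mapsto\Psi^+(-\tfrac12)a^-(-\tfrac12)\mathbf 1$, $E_{2,1}\mapsto\Psi^-(-\tfrac12)a^+(-\tfrac12)\mathbf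 1$, $E_{2,2}\mapsto a^+(-\tfrac12)a^-(-\tfrac12)\mathbf 1-\alpha$. Explicitly, on the vector space $F(\chi^+,\chi^-)\cong F$: $E_{1,1}(z)=\alpha(z)$, $E_{1,2}(z)=\chi^-(z)\Psi^+(z)$, $E_{2,1}(z)=\chi^+(z)\Psi^-(z)$, $E_{2,2}(z)=\chi^+(z)\chi^-(z)-\alpha(z)$, $K=1$. *)

theory Defs
  imports
    Complex_Main
    "HOL-Library.Poly_Mapping"
    "HOL-Library.Z2"
    "HOL-Computational_Algebra.Formal_Laurent_Series"
begin

text \<open>
  Parities are elements of \<open>bit\<close>, i.e. of $Z_2$.  \<open>mode V a n b\<close> is $a_{(n)} b$, where
  $Y(a,z) = \sum_n a_{(n)} z^{-n-1}$.  Vector spaces are whole types with an explicit scalar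
  multiplication by complex numbers.  Infinite sums over modes are written \<open>Sum_any\<close>; in all of
  them only finitely many summands are nonzero, by truncation.
\<close>

record 'v vsa =
  smult :: "complex \<Rightarrow> 'v \<Rightarrow> 'v"
  part :: "bit \<Rightarrow> 'v set"
  vacuum :: 'v
  mode :: "'v \<Rightarrow> int \<Rightarrow> 'v \<Rightarrow> 'v"

record ('v, 'w) vmod =
  msmult :: "complex \<Rightarrow> 'w \<Rightarrow> 'w"
  mpart :: "bit \<Rightarrow> 'w set"
  mact :: "'v \<Rightarrow> int \<Rightarrow> 'w \<Rightarrow> 'w"

definition superspace :: "(complex \<Rightarrow> 'v \<Rightarrow> 'v) \<Rightarrow> (bit \<Rightarrow> 'v::ab_group_add set) \<Rightarrow> bool" where
  "superspace s P \<longleftrightarrow> vector_space s \<and> (\<forall>p. module.subspace s (P p))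
     \<and> P 0 \<inter> P 1 = {0} \<and> (\<forall>v. \<exists>x\<in>P 0. \<exists>y\<in>P 1. v = x + y)"

definition koszul :: "bit \<Rightarrow> bit \<Rightarrow> complex" where
  "koszul p q = (if p = 1 \<and> q = 1 then -1 else 1)"

text \<open>The Borcherds (Jacobi) identity in components, for \<open>V\<close> acting through \<open>act\<close>.\<close>

definition borcherds_identity ::
  "'v vsa \<Rightarrow> (complex \<Rightarrow> 'w \<Rightarrow> 'w) \<Rightarrow> ('v \<Rightarrow> int \<Rightarrow> 'w \<Rightarrow> 'w::ab_group_add) \<Rightarrow> bool" where
  "borcherds_identity V s act \<longleftrightarrow>
     (\<forall>p q. \<forall>a\<in>part V p. \<forall>b\<in>part V q. \<forall>c. \<forall>l m n :: int.
        (\<Sum>j::nat. s (of_int m gchoose j) (act (mode V a (l + int j) b) (m + n - int j) c)) =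
        (\<Sum>j::nat. s ((-1) ^ j * (of_int l gchoose j))
           (act a (m + l - int j) (act b (n + int j) c)
            - s (koszul p q * (-1) powi l) (act b (n + l - int j) (act a (m + int j) c)))))"

definition vertex_action ::
  "'v::ab_group_add vsa \<Rightarrow> (complex \<Rightarrow> 'w \<Rightarrow> 'w) \<Rightarrow> (bit \<Rightarrow> 'w::ab_group_add set)
     \<Rightarrow> ('v \<Rightarrow> int \<Rightarrow> 'w \<Rightarrow> 'w) \<Rightarrow> bool" where
  "vertex_action V s P act \<longleftrightarrow>
     superspace s P
     \<and> (\<forall>a n. Vector_Spaces.linear s s (act a n))
     \<and> (\<forall>n w. Vector_Spaces.linear (smult V) s (\<lambda>a. act a n w))
     \<and> (\<forall>p q n. \<forall>a\<in>part V p. \<forall>w\<in>P q. act a n w \<in> P (p + q))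
     \<and> (\<forall>a w. \<exists>N. \<forall>n\<ge>N. act a n w = 0)
     \<and> (\<forall>n w. act (vacuum V) n w = (if n = -1 then w else 0))
     \<and> borcherds_identity V s act"

definition vertex_superalgebra :: "'v::ab_group_add vsa \<Rightarrow> bool" where
  "vertex_superalgebra V \<longleftrightarrow>
     vertex_action V (smult V) (part V) (mode V)
     \<and> vacuum V \<in> part V 0
     \<and> (\<forall>a. mode V a (-1) (vacuum V) = a \<and> (\<forall>n\<ge>0. mode V a n (vacuum V) = 0))"

definition vertex_module :: "'v::ab_group_add vsa \<Rightarrow> ('v, 'w::ab_group_add) vmod \<Rightarrow> bool" where
  "vertex_module V W \<longleftrightarrow>
     vertex_superalgebra V \<and> vertex_action V (msmult W) (mpart W) (mact W)"

text \<open>Submodules are not required to be \<open>bit\<close>-graded, so that irreducibility is the strong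
  (ungraded) notion; it implies the graded one.\<close>

definition submodule :: "('v, 'w::ab_group_add) vmod \<Rightarrow> 'w set \<Rightarrow> bool" where
  "submodule W U \<longleftrightarrow> module.subspace (msmult W) U \<and> (\<forall>a n. \<forall>w\<in>U. mact W a n w \<in> U)"

definition irreducible_module :: "'v::ab_group_add vsa \<Rightarrow> ('v, 'w::ab_group_add) vmod \<Rightarrow> bool" where
  "irreducible_module V W \<longleftrightarrow>
     vertex_module V W \<and> (\<exists>w::'w. w \<noteq> 0) \<and> (\<forall>U. submodule W U \<longrightarrow> U = {0} \<or> U = UNIV)"

definition vsa_hom :: "'v::ab_group_add vsa \<Rightarrow> 'u::ab_group_add vsa \<Rightarrow> ('v \<Rightarrow> 'u) \<Rightarrow> bool" where
  "vsa_hom V U \<phi> \<longleftrightarrow>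
     Vector_Spaces.linear (smult V) (smult U) \<phi>
     \<and> (\<forall>p. \<phi> ` part V p \<subseteq> part U p)
     \<and> \<phi> (vacuum V) = vacuum U
     \<and> (\<forall>a n b. \<phi> (mode V a n b) = mode U (\<phi> a) n (\<phi> b))"

definition pullback :: "('v \<Rightarrow> 'u) \<Rightarrow> ('u, 'w) vmod \<Rightarrow> ('v, 'w) vmod" where
  "pullback \<phi> W = \<lparr>msmult = msmult W, mpart = mpart W, mact = (\<lambda>a. mact W (\<phi> a))\<rparr>"

text \<open>Lists form the free monoid, so \<open>'a list \<Rightarrow>\<^sub>0 complex\<close> is the tensor algebra on
  the free vector space over \<open>'a\<close>.\<close>

instantiation list :: (type) monoid_add
begin
definition zero_list :: "'a list" where "zero_list = []"
definition plus_list :: "'a list \<Rightarrow> 'a list \<Rightarrow> 'a list" where "plus_list = (@)"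
instance by standard (simp_all add: zero_list_def plus_list_def)
end

datatype idx = Ix1 | Ix2

fun idx_parity :: "idx \<Rightarrow> bit" where
  "idx_parity Ix1 = 0"
| "idx_parity Ix2 = 1"

text \<open>\<open>Egen i j r\<close> is $E_{i,j}(r)$ and \<open>Kgen\<close> is the central element $K$.\<close>

datatype gen = Egen idx idx int | Kgen

fun gen_parity :: "gen \<Rightarrow> bit" where
  "gen_parity (Egen i j r) = idx_parity i + idx_parity j"
| "gen_parity Kgen = 0"

type_synonym tensor = "gen list \<Rightarrow>\<^sub>0 complex"

definition scal :: "complex \<Rightarrow> tensor" where
  "scal c = Poly_Mapping.single [] c"

definition letter :: "gen \<Rightarrow> tensor" where
  "letter x = Poly_Mapping.single [x] 1"

fun bracket :: "gen \<Rightarrow> gen \<Rightarrow> tensor" where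
  "bracket (Egen i j r) (Egen k l s) =
     (if k = j then letter (Egen i l (r + s)) else 0)
     - (if i = l then scal (koszul (idx_parity i + idx_parity j) (idx_parity k + idx_parity l))
                      * letter (Egen k j (r + s)) else 0)
     + (if i = j \<and> k = l \<and> r + s = 0
        then scal ((if idx_parity i + idx_parity k = 1 then -1 else 1) * of_int r) * letter Kgen
        else 0)"
| "bracket Kgen x = 0"
| "bracket x Kgen = 0"

text \<open>The quotient of the tensor algebra by \<open>vcri_rel\<close> is
  $U(\hat g) \otimes_{U(P)} C v$: the family \<open>commutator\<close> spans the two-sided ideal defining
  $U(\hat g)$, and \<open>annihilate\<close>, \<open>level\<close> span the left ideal generated by
  $g \otimes C[t]$ and $K - 1$.\<close>

inductive_set vcri_rel :: "tensor set" where
  commutator: "p * (letter x * letter y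
      - scal (koszul (gen_parity x) (gen_parity y)) * letter y * letter x
      - bracket x y) * q \<in> vcri_rel"
| annihilate: "r \<ge> 0 \<Longrightarrow> p * letter (Egen i j r) \<in> vcri_rel"
| level: "p * (letter Kgen - 1) \<in> vcri_rel"
| add: "p \<in> vcri_rel \<Longrightarrow> q \<in> vcri_rel \<Longrightarrow> p + q \<in> vcri_rel"

lemma vcri_rel_mult: "p \<in> vcri_rel \<Longrightarrow> t * p \<in> vcri_rel"
proof (induction rule: vcri_rel.induct)
  case (commutator p x y q)
  show ?case using vcri_rel.commutator[of "t * p" x y q] by (simp add: mult.assoc)
next
  case (annihilate r p i j)
  then show ?case using vcri_rel.annihilate[of r "t * p" i j] by (simp add: mult.assoc)
next
  case (level p)
  show ?case using vcri_rel.level[of "t * p"] by (simp add: mult.assoc)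
next
  case (add p q)
  then show ?case by (simp add: distrib_left vcri_rel.add)
qed

lemma vcri_rel_zero: "0 \<in> vcri_rel"
  using vcri_rel.level[of 0] by simp

lemma vcri_rel_minus: "p \<in> vcri_rel \<Longrightarrow> - p \<in> vcri_rel"
  using vcri_rel_mult[of p "- 1"] by simp

lemma vcri_rel_minus_commute: "p - q \<in> vcri_rel \<Longrightarrow> q - p \<in> vcri_rel"
  using vcri_rel_minus[of "p - q"] by simp

quotient_type vcri = tensor / "\<lambda>p q. p - q \<in> vcri_rel"
proof (rule equivpI)
  show "reflp (\<lambda>p q. p - q \<in> vcri_rel)"
    by (simp add: reflp_def vcri_rel_zero)
  show "symp (\<lambda>p q. p - q \<in> vcri_rel)"
    by (simp add: symp_def vcri_rel_minus_commute)
  show "transp (\<lambda>p q. p - q \<in> vcri_rel)"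
  proof (rule transpI)
    fix p q r :: tensor
    assume "p - q \<in> vcri_rel" "q - r \<in> vcri_rel"
    then have "(p - q) + (q - r) \<in> vcri_rel" by (rule vcri_rel.add)
    then show "p - r \<in> vcri_rel" by simp
  qed
qed

instantiation vcri :: ab_group_add
begin

lift_definition zero_vcri :: vcri is 0 .

lift_definition plus_vcri :: "vcri \<Rightarrow> vcri \<Rightarrow> vcri" is "(+)"
  using vcri_rel.add by (metis add_diff_add)

lift_definition uminus_vcri :: "vcri \<Rightarrow> vcri" is uminus
  by (metis minus_diff_minus vcri_rel_minus)

definition minus_vcri :: "vcri \<Rightarrow> vcri \<Rightarrow> vcri" where
  "minus_vcri a b = a + - b"

instance
proof
  fix a b c :: vcri
  show "a + b + c = a + (b + c)" by transfer (simp add: add.assoc vcri_rel_zero)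
  show "a + b = b + a" by transfer (simp add: add.commute vcri_rel_zero)
  show "0 + a = a" by transfer (simp add: vcri_rel_zero)
  show "- a + a = 0" by transfer (simp add: vcri_rel_zero)
  show "a - b = a + - b" by (rule minus_vcri_def)
qed

end

lift_definition vcri_smult :: "complex \<Rightarrow> vcri \<Rightarrow> vcri" is "\<lambda>c p. scal c * p"
  by (metis right_diff_distrib vcri_rel_mult)

lift_definition vcri_act :: "gen \<Rightarrow> vcri \<Rightarrow> vcri" is "\<lambda>x p. letter x * p"
  by (metis right_diff_distrib vcri_rel_mult)

lift_definition vcri_vac :: vcri is 1 .

definition vcri_E :: "idx \<Rightarrow> idx \<Rightarrow> vcri" where
  "vcri_E i j = vcri_act (Egen i j (-1)) vcri_vac"

text \<open>\<open>V\<close> is the vertex superalgebra structure on the induced module with vacuum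
  $1 \otimes v$ and fields $Y(E_{i,j}(-1)1,z) = \sum_r E_{i,j}(r) z^{-r-1}$.  Since the
  $E_{i,j}(r)$ generate the module from the vacuum, these conditions determine \<open>V\<close>, its
  grading included.\<close>

definition is_Vcri :: "vcri vsa \<Rightarrow> bool" where
  "is_Vcri V \<longleftrightarrow>
     vertex_superalgebra V
     \<and> smult V = vcri_smult
     \<and> vacuum V = vcri_vac
     \<and> (\<forall>i j. vcri_E i j \<in> part V (idx_parity i + idx_parity j))
     \<and> (\<forall>i j r. mode V (vcri_E i j) r = vcri_act (Egen i j r))"

datatype pm = Plus | Minus

text \<open>\<open>\<Psi> s m\<close> is the half-integral mode $\Psi^s(m + 1/2)$, so that
  $\Psi^s(z) = \sum_m$ \<open>\<Psi> s m\<close> $z^{-m-1}$, and $m + 1/2 > 0$ means \<open>m \<ge> 0\<close>.\<close>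

definition clifford_fock ::
  "(complex \<Rightarrow> 'f \<Rightarrow> 'f) \<Rightarrow> 'f \<Rightarrow> (pm \<Rightarrow> int \<Rightarrow> 'f \<Rightarrow> 'f::ab_group_add) \<Rightarrow> bool" where
  "clifford_fock s v \<Psi> \<longleftrightarrow>
     vector_space s
     \<and> (\<forall>e m. Vector_Spaces.linear s s (\<Psi> e m))
     \<and> (\<forall>m n w. \<Psi> Plus m (\<Psi> Minus n w) + \<Psi> Minus n (\<Psi> Plus m w)
                 = (if m + n + 1 = 0 then w else 0))
     \<and> (\<forall>e m n w. \<Psi> e m (\<Psi> e n w) + \<Psi> e n (\<Psi> e m w) = 0)
     \<and> (\<forall>e. \<forall>m\<ge>0. \<Psi> e m v = 0)
     \<and> v \<noteq> 0
     \<and> (\<forall>U. module.subspace s U \<and> v \<in> U \<and> (\<forall>e m. \<Psi> e m ` U \<subseteq> U) \<longrightarrow> U = UNIV)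
     \<and> (\<forall>U. module.subspace s U \<and> (\<forall>e m. \<Psi> e m ` U \<subseteq> U) \<longrightarrow> U = {0} \<or> U = UNIV)"

definition is_clifford_vsa :: "'f::ab_group_add vsa \<Rightarrow> (pm \<Rightarrow> int \<Rightarrow> 'f \<Rightarrow> 'f) \<Rightarrow> bool" where
  "is_clifford_vsa F \<Psi> \<longleftrightarrow>
     vertex_superalgebra F
     \<and> clifford_fock (smult F) (vacuum F) \<Psi>
     \<and> (\<forall>e. \<Psi> e (-1) (vacuum F) \<in> part F 1)
     \<and> (\<forall>e m. mode F (\<Psi> e (-1) (vacuum F)) m = \<Psi> e m)"

definition fermion_alpha :: "'f vsa \<Rightarrow> (pm \<Rightarrow> int \<Rightarrow> 'f \<Rightarrow> 'f) \<Rightarrow> 'f" where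
  "fermion_alpha F \<Psi> = \<Psi> Plus (-1) (\<Psi> Minus (-1) (vacuum F))"

text \<open>The variable \<open>(e, k)\<close> is $a^e(-k-1/2)$, so that $a^e(z) = \sum_k$ \<open>(e, k)\<close> $z^k$.\<close>

type_synonym mono = "(pm \<times> nat) \<Rightarrow>\<^sub>0 nat"
type_synonym mpol = "mono \<Rightarrow>\<^sub>0 complex"

definition avar :: "pm \<Rightarrow> nat \<Rightarrow> mpol" where
  "avar e k = Poly_Mapping.single (Poly_Mapping.single (e, k) 1) 1"

definition mpol_smult :: "complex \<Rightarrow> mpol \<Rightarrow> mpol" where
  "mpol_smult c p = Poly_Mapping.single 0 c * p"

definition mpol_subst ::
  "(complex \<Rightarrow> 'r) \<Rightarrow> (pm \<Rightarrow> nat \<Rightarrow> 'r) \<Rightarrow> mpol \<Rightarrow> 'r::comm_ring_1" where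
  "mpol_subst \<iota> c p =
     (\<Sum>\<mu>\<in>Poly_Mapping.keys p. \<iota> (Poly_Mapping.lookup p \<mu>) *
        (\<Prod>(e, k)\<in>Poly_Mapping.keys \<mu>. c e k ^ Poly_Mapping.lookup \<mu> (e, k)))"

text \<open>As \<open>M\<close> is commutative, the field of a polynomial in the \<open>(e, k)\<close> is the same polynomial
  in the fields of the \<open>(e, k)\<close>, and the field of \<open>(e, k)\<close> is the divided derivative
  $\partial_z^k a^e(z) / k!$ acting by multiplication; its coefficient at $z^j$ is
  \<open>(k + j choose k)\<close> times \<open>(e, k + j)\<close>.\<close>

definition M_field :: "mpol \<Rightarrow> mpol fps" where
  "M_field = mpol_subst (\<lambda>c. fps_const (Poly_Mapping.single 0 c))
     (\<lambda>e k. Abs_fps (\<lambda>j. of_nat (k + j choose k) * avar e (k + j)))"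

definition M_vsa :: "mpol vsa" where
  "M_vsa = \<lparr>smult = mpol_smult, part = (\<lambda>p. if p = 0 then UNIV else {0}), vacuum = 1,
     mode = (\<lambda>p n q. if n < 0 then fps_nth (M_field p) (nat (- n - 1)) * q else 0)\<rparr>"

text \<open>In the same way, the field of a polynomial on $M(\chi^+,\chi^-)$ is that polynomial in
  the $\partial_z^k \chi^e(z) / k!$.\<close>

definition Mchi_field :: "(pm \<Rightarrow> complex fls) \<Rightarrow> mpol \<Rightarrow> complex fls" where
  "Mchi_field \<chi> = mpol_subst fls_const
     (\<lambda>e k. fls_const (1 / fact k) * (fls_deriv ^^ k) (\<chi> e))"

definition Mchi :: "complex fls \<Rightarrow> complex fls \<Rightarrow> (mpol, complex) vmod" where
  "Mchi \<chi>p \<chi>m = \<lparr>msmult = (*), mpart = (\<lambda>p. if p = 0 then UNIV else {0}),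
     mact = (\<lambda>p n c. fls_nth (Mchi_field (\<lambda>e. case e of Plus \<Rightarrow> \<chi>p | Minus \<Rightarrow> \<chi>m) p) (- n - 1) * c)\<rparr>"

lemma Mchi_avar:
  "mact (Mchi \<chi>p \<chi>m) (avar Plus 0) n c = fls_nth \<chi>p (- n - 1) * c"
  "mact (Mchi \<chi>p \<chi>m) (avar Minus 0) n c = fls_nth \<chi>m (- n - 1) * c"
  by (simp_all add: Mchi_def Mchi_field_def mpol_subst_def avar_def)

text \<open>$F \otimes M$ is represented by \<open>F\<close>-valued polynomials, i.e. by the coefficients with
  respect to the monomial basis of \<open>M\<close>.  There are no signs in the tensor product because
  \<open>M\<close> is purely even.\<close>

type_synonym 'f FM = "mono \<Rightarrow>\<^sub>0 'f"

definition tens :: "'f::ab_group_add vsa \<Rightarrow> 'f \<Rightarrow> mpol \<Rightarrow> 'f FM" where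
  "tens F f p = Poly_Mapping.map (\<lambda>c. smult F c f) p"

definition monom :: "mono \<Rightarrow> mpol" where
  "monom \<mu> = Poly_Mapping.single \<mu> 1"

definition FM_vsa :: "'f::ab_group_add vsa \<Rightarrow> 'f FM vsa" where
  "FM_vsa F = \<lparr>
     smult = (\<lambda>c. Poly_Mapping.map (smult F c)),
     part = (\<lambda>p. {u. \<forall>\<mu>. Poly_Mapping.lookup u \<mu> \<in> part F p}),
     vacuum = tens F (vacuum F) (vacuum M_vsa),
     mode = (\<lambda>u n w. \<Sum>\<mu>\<in>Poly_Mapping.keys u. \<Sum>\<nu>\<in>Poly_Mapping.keys w.
       Sum_any (\<lambda>k::int.
         tens F (mode F (Poly_Mapping.lookup u \<mu>) k (Poly_Mapping.lookup w \<nu>))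
                (mode M_vsa (monom \<mu>) (n - k - 1) (monom \<nu>))))\<rparr>"

text \<open>The underlying space of $F \otimes M(\chi^+,\chi^-)$ is $F \otimes C$, identified with
  \<open>F\<close>.\<close>

definition FMchi :: "'f::ab_group_add vsa \<Rightarrow> complex fls \<Rightarrow> complex fls \<Rightarrow> ('f FM, 'f) vmod" where
  "FMchi F \<chi>p \<chi>m = \<lparr>
     msmult = smult F,
     mpart = part F,
     mact = (\<lambda>u n f. \<Sum>\<mu>\<in>Poly_Mapping.keys u.
       Sum_any (\<lambda>k::int.
         smult F (mact (Mchi \<chi>p \<chi>m) (monom \<mu>) (n - k - 1) 1)
                 (mode F (Poly_Mapping.lookup u \<mu>) k f)))\<rparr>"

definition is_realization ::
  "'f::ab_group_add vsa \<Rightarrow> (pm \<Rightarrow> int \<Rightarrow> 'f \<Rightarrow> 'f) \<Rightarrow> vcri vsa \<Rightarrow> (vcri \<Rightarrow> 'f FM) \<Rightarrow> bool" where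
  "is_realization F \<Psi> V \<phi> \<longleftrightarrow>
     vsa_hom V (FM_vsa F) \<phi>
     \<and> \<phi> (vcri_E Ix1 Ix1) = tens F (fermion_alpha F \<Psi>) 1
     \<and> \<phi> (vcri_E Ix1 Ix2) = tens F (\<Psi> Plus (-1) (vacuum F)) (avar Minus 0)
     \<and> \<phi> (vcri_E Ix2 Ix1) = tens F (\<Psi> Minus (-1) (vacuum F)) (avar Plus 0)
     \<and> \<phi> (vcri_E Ix2 Ix2) = tens F (vacuum F) (avar Plus 0 * avar Minus 0)
                              - tens F (fermion_alpha F \<Psi>) 1"

definition F_chi ::
  "'f::ab_group_add vsa \<Rightarrow> (vcri \<Rightarrow> 'f FM) \<Rightarrow> complex fls \<Rightarrow> complex fls \<Rightarrow> (vcri, 'f) vmod" where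
  "F_chi F \<phi> \<chi>p \<chi>m = pullback \<phi> (FMchi F \<chi>p \<chi>m)"

end

theory Submission
  imports Defs
begin

text \<open>Every field $A(z) Y(f,z)$ with $0 \ne A \in C((z))$ generates the same submodules as $Y(f,z)$:
  the series \<open>A\<close> is invertible in the field $C((z))$, and $Y(f,z) = A(z)^{-1} (A(z) Y(f,z))$
  involves only finite sums on each vector, by truncation
  (\<open>mode_in_smear_invariant_subspace\<close>).  On $F(\chi^+,\chi^-)$ the odd generators act by
  $\chi^-(z) \Psi^+(z)$ and $\chi^+(z) \Psi^-(z)$, so a submodule is stable under all modes of
  $\Psi^\pm$, and \<open>F\<close> is irreducible over the Clifford algebra.

  The larger part of the proof shows that $F(\chi^+,\chi^-)$ is a module at all.  Module structures
  pull back along homomorphisms (\<open>vertex_action_pullback\<close>), so the point is the Borcherds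
  identity for $F \otimes M$ acting on \<open>F\<close>.  Here $f \otimes p$ acts by $A(z) Y(f,z)$, where \<open>A\<close>
  is the series by which the field of \<open>p\<close> acts on $M(\chi^+,\chi^-)$.  The map from \<open>p\<close> to
  \<open>A\<close> is a ring homomorphism and takes the translation operator of \<open>M\<close> to $\partial_z$
  (\<open>Mchi_field_coeff_M_field\<close>).  Therefore $Y(f \otimes p,x) (g \otimes q)$ acts by
  $A(z + x) B(z) Y(Y(f,x) g,z)$, where \<open>B\<close> belongs to \<open>q\<close>.  Now write $A = \sum_r a_r z^r$ and
  $B = \sum_s b_s z^s$.  The identity with indices $l$, $m$, $n$ for $A(z) Y(f,z)$ and
  $B(z) Y(g,z)$ is the sum, with coefficients $a_r b_s$, of the identities of \<open>F\<close> with indices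
  $l$, $m + r$, $n + s$; on the side of the iterated product this is Vandermonde's identity
  (\<open>smear_borcherds_left\<close>), on the side of the commutator it is a relabelling
  (\<open>smear_borcherds_right\<close>).  All sums are finite, because \<open>A\<close> and \<open>B\<close> are bounded below
  and the modes of \<open>F\<close> truncate.\<close>

section \<open>Substitution in polynomials\<close>

definition monomial_value :: "(pm \<Rightarrow> nat \<Rightarrow> 'r::comm_ring_1) \<Rightarrow> mono \<Rightarrow> 'r" where
  "monomial_value c \<mu> = (\<Prod>(e, k)\<in>Poly_Mapping.keys \<mu>. c e k ^ Poly_Mapping.lookup \<mu> (e, k))"

lemma monomial_value_superset:
  assumes "finite S" "Poly_Mapping.keys \<mu> \<subseteq> S"
  shows "monomial_value c \<mu> = (\<Prod>(e, k)\<in>S. c e k ^ Poly_Mapping.lookup \<mu> (e, k))"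
  unfolding monomial_value_def
  by (rule prod.mono_neutral_left) (use assms in \<open>auto simp: in_keys_iff\<close>)

lemma monomial_value_add: "monomial_value c (\<mu> + \<nu>) = monomial_value c \<mu> * monomial_value c \<nu>"
proof -
  let ?S = "Poly_Mapping.keys \<mu> \<union> Poly_Mapping.keys \<nu>"
  have "monomial_value c (\<mu> + \<nu>)
      = (\<Prod>(e, k)\<in>?S. c e k ^ Poly_Mapping.lookup \<mu> (e, k) * c e k ^ Poly_Mapping.lookup \<nu> (e, k))"
    by (subst monomial_value_superset[of ?S])
      (use keys_add[of \<mu> \<nu>] in \<open>auto simp: lookup_add power_add\<close>)
  also have "\<dots> = monomial_value c \<mu> * monomial_value c \<nu>"
    by (simp add: monomial_value_superset[of ?S] split_def prod.distrib)
  finally show ?thesis .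
qed

lemma poly_mapping_sum_monomials:
  fixes p :: "'a \<Rightarrow>\<^sub>0 'b::comm_monoid_add"
  shows "(\<Sum>\<mu>\<in>Poly_Mapping.keys p. Poly_Mapping.single \<mu> (Poly_Mapping.lookup p \<mu>)) = p"
  by (rule poly_mapping_eqI)
    (simp add: lookup_sum lookup_single when_def in_keys_iff sum.delta)

lemma mpol_subst_eq:
  "mpol_subst \<iota> c p
    = (\<Sum>\<mu>\<in>Poly_Mapping.keys p. \<iota> (Poly_Mapping.lookup p \<mu>) * monomial_value c \<mu>)"
  by (simp add: mpol_subst_def monomial_value_def)

locale coefficient_hom =
  fixes \<iota> :: "complex \<Rightarrow> 'r::comm_ring_1"
  assumes hom_zero: "\<iota> 0 = 0" and hom_one: "\<iota> 1 = 1"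
    and hom_add: "\<iota> (a + b) = \<iota> a + \<iota> b" and hom_mult: "\<iota> (a * b) = \<iota> a * \<iota> b"
begin

lemma mpol_subst_single: "mpol_subst \<iota> c (Poly_Mapping.single \<mu> a) = \<iota> a * monomial_value c \<mu>"
  by (simp add: mpol_subst_eq hom_zero)

lemma mpol_subst_zero: "mpol_subst \<iota> c 0 = 0"
  by (simp add: mpol_subst_eq)

lemma mpol_subst_add: "mpol_subst \<iota> c (p + q) = mpol_subst \<iota> c p + mpol_subst \<iota> c q"
  unfolding mpol_subst_eq
  by (rule setsum_keys_plus_distrib) (simp_all add: hom_zero hom_add distrib_right)

lemma mpol_subst_one: "mpol_subst \<iota> c 1 = 1"
  using mpol_subst_single[of c 0 1] by (simp add: hom_one monomial_value_def)

lemma mpol_subst_avar: "mpol_subst \<iota> c (avar e k) = c e k"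
  by (simp add: avar_def mpol_subst_single hom_one monomial_value_def)

lemma mpol_subst_sum: "mpol_subst \<iota> c (sum f S) = (\<Sum>x\<in>S. mpol_subst \<iota> c (f x))"
  by (induction S rule: infinite_finite_induct) (simp_all add: mpol_subst_zero mpol_subst_add)

lemma mpol_subst_mult: "mpol_subst \<iota> c (p * q) = mpol_subst \<iota> c p * mpol_subst \<iota> c q"
proof -
  have "mpol_subst \<iota> c (p * q) = (\<Sum>\<mu>\<in>Poly_Mapping.keys p. \<Sum>\<nu>\<in>Poly_Mapping.keys q.
      mpol_subst \<iota> c (Poly_Mapping.single \<mu> (Poly_Mapping.lookup p \<mu>)
        * Poly_Mapping.single \<nu> (Poly_Mapping.lookup q \<nu>)))"
    unfolding mpol_subst_sum[symmetric] sum_product[symmetric] poly_mapping_sum_monomials ..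
  also have "\<dots> = mpol_subst \<iota> c p * mpol_subst \<iota> c q"
    unfolding mpol_subst_eq[of _ _ p] mpol_subst_eq[of _ _ q] sum_product
    by (intro sum.cong refl)
      (simp add: mult_single mpol_subst_single monomial_value_add hom_mult mult_ac)
  finally show ?thesis .
qed

text \<open>Ring homomorphisms out of the polynomial ring are compared by writing both as substitutions,
  which agree as soon as they agree on constants and on variables.\<close>

lemma ring_hom_mpol_subst:
  fixes h :: "'r \<Rightarrow> 's::comm_ring_1"
  assumes h0: "h 0 = 0" and h1: "h 1 = 1" and hadd: "\<And>a b. h (a + b) = h a + h b"
    and hmult: "\<And>a b. h (a * b) = h a * h b"
  shows "h (mpol_subst \<iota> c p) = mpol_subst (\<lambda>a. h (\<iota> a)) (\<lambda>e k. h (c e k)) p"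
proof -
  have hsum: "h (sum f S) = (\<Sum>x\<in>S. h (f x))" for f :: "mono \<Rightarrow> 'r" and S
    by (induction S rule: infinite_finite_induct) (simp_all add: h0 hadd)
  have hprod: "h (prod f S) = (\<Prod>x\<in>S. h (f x))" for f :: "pm \<times> nat \<Rightarrow> 'r" and S
    by (induction S rule: infinite_finite_induct) (simp_all add: h1 hmult)
  have hpow: "h (a ^ n) = h a ^ n" for a n
    by (induction n) (simp_all add: h1 hmult)
  show ?thesis
    by (simp add: mpol_subst_def hsum hprod hpow hmult split_def)
qed

end

section \<open>Taylor expansion of Laurent series\<close>

text \<open>The divided derivative $\partial^i A / i!$ (Hasse derivative), i.e. the coefficient of $x^i$
  in $A(z + x)$.\<close>

definition hasse :: "nat \<Rightarrow> complex fls \<Rightarrow> complex fls" where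
  "hasse i A = fls_const (1 / fact i) * (fls_deriv ^^ i) A"

lemma hasse_0 [simp]: "hasse 0 A = A"
  by (simp add: hasse_def)

lemma fls_deriv_hasse: "fls_deriv (hasse i A) = of_nat (Suc i) * hasse (Suc i) A"
proof -
  have "(1 / fact i :: complex) = of_nat (Suc i) * (1 / fact (Suc i))"
    by (simp add: field_simps del: of_nat_Suc)
  then have "fls_const (1 / fact i :: complex) = of_nat (Suc i) * fls_const (1 / fact (Suc i))"
    by (metis fls_const_mult_const fls_of_nat)
  then show ?thesis by (simp add: hasse_def mult.assoc del: of_nat_Suc)
qed

text \<open>$\partial_z^i z^r / i! = {r \choose i} z^{r-i}$ with $r = t + i$, which may be negative; hence
  the generalized binomial coefficient.\<close>

lemma fls_nth_hasse: "fls_nth (hasse i A) t = (of_int (t + int i) gchoose i) * fls_nth A (t + int i)"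
proof (induction i arbitrary: t)
  case 0
  then show ?case by simp
next
  case (Suc i)
  let ?x = "of_int (t + int (Suc i)) :: complex"
  have "of_nat (Suc i) * fls_nth (hasse (Suc i) A) t = fls_nth (fls_deriv (hasse i A)) t"
    by (simp add: fls_deriv_hasse fls_of_nat del: of_nat_Suc fls_deriv_nth)
  also have "\<dots> = of_int (t + 1) * ((?x gchoose i) * fls_nth A (t + int (Suc i)))"
    using Suc.IH[of "t + 1"] by (simp add: add_ac)
  also have "\<dots> = (of_int (t + 1) * (?x gchoose i)) * fls_nth A (t + int (Suc i))"
    by (simp only: mult.assoc)
  also have "of_int (t + 1) * (?x gchoose i) = of_nat (Suc i) * (?x gchoose Suc i)"
    using gbinomial_mult_1[of ?x i] by (simp add: algebra_simps)
  finally show ?case by (simp add: mult.assoc del: of_nat_Suc) 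
qed

text \<open>The expansion of $A(z + x)$ in nonnegative powers of \<open>x\<close>, with coefficients in $C((z))$.\<close>

definition taylor :: "complex fls \<Rightarrow> complex fls fps" where
  "taylor A = Abs_fps (\<lambda>i. hasse i A)"

text \<open>Both sides solve $\partial_x P = \partial_z P$ with initial value $A(z) B(z)$ at $x = 0$: the
  right-hand side because $\partial_z$, applied to each coefficient, is a derivation.  The
  equation determines the coefficients of \<open>P\<close> recursively.\<close>

lemma taylor_mult: "taylor (A * B) = taylor A * taylor B"
proof (rule fps_ext)
  fix n show "fps_nth (taylor (A * B)) n = fps_nth (taylor A * taylor B) n"
  proof (induction n)
    case 0
    then show ?case by (simp add: taylor_def)
  next
    case (Suc n)
    \<comment> \<open>the equation $\partial_x P = \partial_z P$ for a single Taylor expansion\<close>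
    have d: "fps_deriv (taylor C) = Abs_fps (\<lambda>i. fls_deriv (hasse i C))" for C
      by (rule fps_ext) (simp add: taylor_def fls_deriv_hasse del: of_nat_Suc)
    have "of_nat (Suc n) * fps_nth (taylor A * taylor B) (Suc n)
        = fps_nth (fps_deriv (taylor A * taylor B)) n"
      by (simp only: fps_deriv_nth Suc_eq_plus1)
    also have "\<dots> = fps_nth (taylor A * fps_deriv (taylor B) + fps_deriv (taylor A) * taylor B) n"
      by (simp only: fps_deriv_mult)
    also have "\<dots> = fls_deriv (fps_nth (taylor A * taylor B) n)"
      by (simp add: d fps_mult_nth fls_deriv_sum sum.distrib) (simp add: taylor_def)
    also have "\<dots> = of_nat (Suc n) * fps_nth (taylor (A * B)) (Suc n)"
      by (simp only: Suc.IH[symmetric]) (simp add: taylor_def fls_deriv_hasse del: of_nat_Suc)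
    finally show ?case by (simp del: of_nat_Suc)
  qed
qed

text \<open>This coefficient is the one in the definition of \<open>M_field\<close>, so the Taylor expansion of
  $\partial^k \chi / k!$ has the shape of the field of the variable \<open>(e, k)\<close>.\<close>

lemma hasse_hasse: "hasse j (hasse k A) = of_nat (k + j choose k) * hasse (k + j) A"
proof -
  have c: "(fls_deriv ^^ j) (fls_const a * B) = fls_const a * (fls_deriv ^^ j) B" for a and B :: "complex fls"
    by (induction j) simp_all
  have "(of_nat (k + j choose k) :: complex) * (1 / fact (k + j)) = 1 / fact j * (1 / fact k)"
    by (subst binomial_fact) (simp_all add: field_simps)
  then have "of_nat (k + j choose k) * fls_const (1 / fact (k + j) :: complex)
      = fls_const (1 / fact j) * fls_const (1 / fact k)"
    by (simp add: fls_of_nat)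
  then show ?thesis
    by (simp add: hasse_def c funpow_add add.commute[of k j] mult.assoc[symmetric])
qed

lemma hasse_simps: "hasse i (A + B) = hasse i A + hasse i B" "hasse i 0 = 0"
  "hasse i (fls_const c) = (if i = 0 then fls_const c else 0)"
proof -
  show "hasse i (A + B) = hasse i A + hasse i B"
    by (rule fls_eqI) (simp add: fls_nth_hasse algebra_simps)
  show "hasse i 0 = 0"
    by (rule fls_eqI) (simp add: fls_nth_hasse)
  have "(fls_deriv ^^ n) 0 = (0 :: complex fls)" for n by (induction n) simp_all
  then show "hasse i (fls_const c) = (if i = 0 then fls_const c else 0)"
    by (cases i) (simp_all add: hasse_def funpow_swap1)
qed

section \<open>The action of $M$ on its one-dimensional modules\<close>

interpretation const_fls: coefficient_hom "fls_const :: complex \<Rightarrow> complex fls"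
  by standard (simp_all add: fls_plus_const)

interpretation const_mpol: coefficient_hom "\<lambda>c. fps_const (Poly_Mapping.single 0 c :: mpol)"
  by standard (simp_all add: single_add mult_single)

lemma Mchi_field_avar: "Mchi_field \<chi> (avar e k) = hasse k (\<chi> e)"
  by (simp add: Mchi_field_def const_fls.mpol_subst_avar hasse_def)

text \<open>The field of \<open>p\<close> on the vacuum module is $e^{x \partial} p$, and $\partial$ acts on
  $M(\chi^+,\chi^-)$ as $\partial_z$.  Applying \<open>Mchi_field\<close> to the coefficients of
  \<open>M_field p\<close> and Taylor expanding \<open>Mchi_field p\<close> are both ring homomorphisms in \<open>p\<close>,
  so it is enough to compare them on constants and on variables.\<close>

lemma Mchi_field_coeff_M_field:
  "Mchi_field \<chi> (fps_nth (M_field p) i) = hasse i (Mchi_field \<chi> p)"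
proof -
  let ?m = "Mchi_field \<chi>"
  define G where "G P = Abs_fps (\<lambda>i. ?m (fps_nth P i))" for P :: "mpol fps"
  have m: "?m 0 = 0" "?m 1 = 1" "?m (p + q) = ?m p + ?m q" "?m (p * q) = ?m p * ?m q"
    "?m (sum f S) = (\<Sum>x\<in>S. ?m (f x))" for p q and f :: "nat \<Rightarrow> mpol" and S
    by (simp_all add: Mchi_field_def const_fls.mpol_subst_zero const_fls.mpol_subst_one
        const_fls.mpol_subst_add const_fls.mpol_subst_mult const_fls.mpol_subst_sum)
  have mn: "?m (of_nat n) = of_nat n" for n by (induction n) (simp_all add: m)
  have "G (M_field p) = mpol_subst (\<lambda>a. G (fps_const (Poly_Mapping.single 0 a)))
      (\<lambda>e k. G (Abs_fps (\<lambda>j. of_nat (k + j choose k) * avar e (k + j)))) p"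
    unfolding M_field_def
    by (rule const_mpol.ring_hom_mpol_subst)
      (simp_all add: G_def fps_eq_iff fps_mult_nth m del: One_nat_def)
  also have "\<dots> = mpol_subst (\<lambda>a. taylor (fls_const a)) (\<lambda>e k. taylor (hasse k (\<chi> e))) p"
  proof -
    have "G (fps_const (Poly_Mapping.single 0 a)) = taylor (fls_const a)" for a
      by (rule fps_ext) (simp add: G_def taylor_def hasse_simps m,
          simp add: Mchi_field_def const_fls.mpol_subst_single monomial_value_def)
    moreover have "G (Abs_fps (\<lambda>j. of_nat (k + j choose k) * avar e (k + j))) = taylor (hasse k (\<chi> e))" for e k
      by (rule fps_ext) (simp add: G_def taylor_def hasse_hasse m mn Mchi_field_avar)
    ultimately show ?thesis by simp
  qed
  also have "\<dots> = taylor (Mchi_field \<chi> p)"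
    unfolding Mchi_field_def hasse_def[symmetric]
    by (rule const_fls.ring_hom_mpol_subst[symmetric])
      (simp_all add: taylor_mult, simp_all add: taylor_def fps_eq_iff hasse_simps flip: fls_const_1)
  finally have "fps_nth (G (M_field p)) i = fps_nth (taylor (Mchi_field \<chi> p)) i" by simp
  then show ?thesis by (simp add: G_def taylor_def)
qed

section \<open>Sums of finite support\<close>

lemma Sum_any_eq_sum: "finite S \<Longrightarrow> (\<And>a. a \<notin> S \<Longrightarrow> g a = 0) \<Longrightarrow> Sum_any g = sum g S"
  by (rule Sum_any.expand_superset) auto

lemma Sum_any_sum:
  assumes "finite T" "\<And>x. x \<in> T \<Longrightarrow> finite {a. g x a \<noteq> 0}"
  shows "Sum_any (\<lambda>a. \<Sum>x\<in>T. g x a) = (\<Sum>x\<in>T. Sum_any (g x))"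
proof -
  let ?S = "\<Union>x\<in>T. {a. g x a \<noteq> 0}"
  have S: "finite ?S" using assms by simp
  have "Sum_any (\<lambda>a. \<Sum>x\<in>T. g x a) = (\<Sum>a\<in>?S. \<Sum>x\<in>T. g x a)"
    by (rule Sum_any_eq_sum[OF S]) (auto intro: sum.neutral)
  also have "\<dots> = (\<Sum>x\<in>T. \<Sum>a\<in>?S. g x a)" by (rule sum.swap)
  also have "\<dots> = (\<Sum>x\<in>T. Sum_any (g x))"
    by (intro sum.cong refl Sum_any_eq_sum[OF S, symmetric]) auto
  finally show ?thesis .
qed

text \<open>The support has to be finite here: otherwise \<open>Sum_any\<close> is \<open>0\<close> by convention, whereas \<open>h\<close> may
  turn the summands into a family of finite support.\<close>

lemma additive_Sum_any:
  assumes h: "h 0 = 0" "\<And>x y. h (x + y) = h x + h y" and fin: "finite {a. g a \<noteq> 0}"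
  shows "h (Sum_any g) = Sum_any (\<lambda>a. h (g a))"
proof -
  have "h (sum g S) = (\<Sum>a\<in>S. h (g a))" for S
    by (induction S rule: infinite_finite_induct) (simp_all add: h)
  moreover have "Sum_any g = sum g {a. g a \<noteq> 0}"
    by (rule Sum_any_eq_sum[OF fin]) simp
  moreover have "Sum_any (\<lambda>a. h (g a)) = (\<Sum>a\<in>{a. g a \<noteq> 0}. h (g a))"
    by (rule Sum_any_eq_sum[OF fin]) (simp add: h(1))
  ultimately show ?thesis by simp
qed

lemma finite_int_bounds: "(\<And>k. k \<in> S \<Longrightarrow> a \<le> k \<and> k < b) \<Longrightarrow> finite (S :: int set)"
  by (rule finite_subset[of _ "{a..<b}"]) auto

lemma Sum_any_nat_shift:
  fixes h :: "nat \<Rightarrow> 'a::comm_monoid_add"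
  shows "Sum_any (\<lambda>k::int. if N \<le> k then h (nat (k - N)) else 0) = Sum_any h"
proof -
  let ?g = "\<lambda>k::int. if N \<le> k then h (nat (k - N)) else 0"
  have inj: "inj_on (\<lambda>i. N + int i) {i. h i \<noteq> 0}" by (simp add: inj_on_def)
  have eq: "{k. ?g k \<noteq> 0} = (\<lambda>i. N + int i) ` {i. h i \<noteq> 0}"
  proof (intro equalityI subsetI)
    fix k assume "k \<in> {k. ?g k \<noteq> 0}"
    then have "k = N + int (nat (k - N))" "h (nat (k - N)) \<noteq> 0" by (auto split: if_splits)
    then show "k \<in> (\<lambda>i. N + int i) ` {i. h i \<noteq> 0}" by blast
  qed auto
  show ?thesis
    unfolding Sum_any.expand_set eq by (subst sum.reindex[OF inj]) simp
qed

section \<open>Fields multiplied by Laurent series\<close>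

text \<open>\<open>smear F A f n\<close> is the coefficient of $z^{-n-1}$ in $A(z) Y(f,z)$.  On each vector the sum
  has finite support, because \<open>A\<close> is bounded below and $f_{(k)} c$ vanishes for large \<open>k\<close>.\<close>

definition smear ::
  "'f::ab_group_add vsa \<Rightarrow> complex fls \<Rightarrow> 'f \<Rightarrow> int \<Rightarrow> 'f \<Rightarrow> 'f" where
  "smear F A f n c = Sum_any (\<lambda>k::int. smult F (fls_nth A (k - n)) (mode F f k c))"

text \<open>One bound for two series lets the double sums over their exponents run over a square.\<close>

lemma fls_lower_bound: "\<exists>L. \<forall>k<L. fls_nth A k = 0 \<and> fls_nth B k = 0"
  by (intro exI[of _ "min (fls_subdegree A) (fls_subdegree B)"]) auto

lemma fls_times_Sum_any:
  assumes "\<forall>k<L. fls_nth A k = 0" "\<forall>k<M. fls_nth B k = (0::complex)"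
  shows "fls_nth (A * B) n = Sum_any (\<lambda>k. fls_nth A (n - k) * fls_nth B k)"
    and "finite {k. fls_nth A (n - k) * fls_nth B k \<noteq> 0}"
proof -
  show "finite {k. fls_nth A (n - k) * fls_nth B k \<noteq> 0}"
  proof (rule finite_int_bounds[of _ M "n - L + 1"])
    fix k assume "k \<in> {k. fls_nth A (n - k) * fls_nth B k \<noteq> 0}"
    then have "\<not> n - k < L" "\<not> k < M" using assms by auto
    then show "M \<le> k \<and> k < n - L + 1" by linarith
  qed
  have "fls_nth (A * B) n = fls_nth (B * A) n" by (simp add: mult.commute)
  also have "\<dots> = (\<Sum>k\<in>{fls_subdegree B..n - fls_subdegree A}. fls_nth B k * fls_nth A (n - k))"
    by (rule fls_times_nth)
  also have "\<dots> = Sum_any (\<lambda>k. fls_nth A (n - k) * fls_nth B k)"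
    by (subst Sum_any_eq_sum[of "{fls_subdegree B..n - fls_subdegree A}"])
      (auto simp: mult.commute not_le)
  finally show "fls_nth (A * B) n = Sum_any (\<lambda>k. fls_nth A (n - k) * fls_nth B k)" .
qed

locale vertex_algebra =
  fixes F :: "'f::ab_group_add vsa"
  assumes vertex_superalgebra: "vertex_superalgebra F"
begin

lemma vertex_action: "vertex_action F (smult F) (part F) (mode F)"
  using vertex_superalgebra by (simp add: vertex_superalgebra_def)

sublocale vector_space "smult F"
  using vertex_action by (simp add: vertex_action_def superspace_def)

lemma mode_right: "Vector_Spaces.linear (smult F) (smult F) (mode F f n)"
  and mode_left: "Vector_Spaces.linear (smult F) (smult F) (\<lambda>f. mode F f n c)"
  using vertex_action by (simp_all add: vertex_action_def)

lemma mode_simps: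
  "mode F f n (c + d) = mode F f n c + mode F f n d"
  "mode F f n (smult F x c) = smult F x (mode F f n c)"
  "mode F (f + g) n c = mode F f n c + mode F g n c"
  "mode F (smult F x f) n c = smult F x (mode F f n c)"
  using mode_right[of f n] mode_left[of n c] by (auto simp: Vector_Spaces.linear_iff)

lemma mode_zero: "mode F f n 0 = 0" "mode F 0 n c = 0"
  using mode_simps(2)[of f n 0 0] mode_simps(4)[of 0 0 n c] by simp_all

lemma mode_sum: "mode F f n (sum h S) = (\<Sum>x\<in>S. mode F f n (h x))"
  by (induction S rule: infinite_finite_induct) (simp_all add: mode_zero mode_simps)

lemma mode_vacuum: "mode F (vacuum F) n c = (if n = -1 then c else 0)"
  using vertex_action by (simp add: vertex_action_def)

lemma truncation: "\<exists>N. \<forall>n\<ge>N. mode F f n c = 0"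
  using vertex_action by (simp add: vertex_action_def)

text \<open>Truncation holds one vector at a time; the interchanges of summation below need one bound for
  finitely many pairs of a state and a vector.\<close>

lemma uniform_truncation: "finite S \<Longrightarrow> \<exists>N. \<forall>n\<ge>N. \<forall>(f, c)\<in>S. mode F f n c = 0"
proof (induction S rule: finite_induct)
  case empty
  then show ?case by simp
next
  case (insert x S)
  obtain N where "\<forall>n\<ge>N. \<forall>(f, c)\<in>S. mode F f n c = 0" using insert.IH by blast
  moreover obtain M where "\<forall>n\<ge>M. mode F (fst x) n (snd x) = 0" using truncation by blast
  ultimately show ?case by (intro exI[of _ "max N M"]) (auto simp: split_def)
qed

text \<open>Although \<open>t\<close> is unbounded above, only finitely many of the vectors $g_{(t)} c$ with
  $t \ge M$ are nonzero.\<close>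

lemma truncation_above:
  assumes "\<forall>t\<ge>N. mode F g t c = 0"
  shows "\<exists>K. \<forall>k\<ge>K. \<forall>t\<ge>M. mode F f k (mode F g t c) = 0"
proof -
  obtain K where "\<forall>n\<ge>K. \<forall>(f, c)\<in>(\<lambda>t. (f, mode F g t c)) ` {M..<N}. mode F f n c = 0"
    using uniform_truncation[of "(\<lambda>t. (f, mode F g t c)) ` {M..<N}"] by auto
  then have "mode F f k (mode F g t c) = 0" if "k \<ge> K" "t \<ge> M" for k t
    using that assms by (cases "t < N") (auto simp: mode_zero)
  then show ?thesis by blast
qed

lemma smear_finite: "finite {k. smult F (fls_nth A (k - n)) (mode F f k c) \<noteq> 0}"
proof -
  obtain N where "\<forall>n\<ge>N. mode F f n c = 0" using truncation by blast
  then have "\<not> N \<le> k" "\<not> k - n < fls_subdegree A"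
    if "smult F (fls_nth A (k - n)) (mode F f k c) \<noteq> 0" for k
    using that by auto
  then show ?thesis
    by (intro finite_int_bounds[of _ "n + fls_subdegree A" N]) force
qed

text \<open>With explicit finite ranges, sums over exponents commute with all other sums by
  \<open>sum.swap\<close>.  Every larger \<open>R\<close> is admitted too, so that one range can serve several terms
  at once.\<close>

lemma smear_eq_sum:
  assumes "\<forall>k<L. fls_nth A k = 0" "\<forall>k\<ge>N. mode F f k c = 0" "N \<le> n + R"
  shows "smear F A f n c = (\<Sum>r\<in>{L..<R}. smult F (fls_nth A r) (mode F f (n + r) c))"
proof -
  have "smear F A f n c = (\<Sum>k\<in>(\<lambda>r. n + r) ` {L..<R}. smult F (fls_nth A (k - n)) (mode F f k c))"
    unfolding smear_def
  proof (rule Sum_any_eq_sum)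
    fix k assume "k \<notin> (\<lambda>r. n + r) ` {L..<R}"
    then have "k - n \<notin> {L..<R}" by (metis add.commute diff_add_cancel image_eqI)
    then have "k - n < L \<or> k \<ge> N" using assms(3) by auto
    then show "smult F (fls_nth A (k - n)) (mode F f k c) = 0" using assms by auto
  qed simp
  then show ?thesis by (subst (asm) sum.reindex) (simp_all add: inj_on_def)
qed

lemma smear_right:
  "smear F A f n (c + d) = smear F A f n c + smear F A f n d"
  "smear F A f n (smult F x c) = smult F x (smear F A f n c)"
  "smear F A f n 0 = 0"
proof -
  show z: "smear F A f n 0 = 0" by (simp add: smear_def mode_zero)
  show "smear F A f n (c + d) = smear F A f n c + smear F A f n d"
    by (simp add: smear_def mode_simps scale_right_distrib
        Sum_any.distrib[OF smear_finite smear_finite])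
  show "smear F A f n (smult F x c) = smult F x (smear F A f n c)"
    unfolding smear_def
    by (subst additive_Sum_any[where h = "smult F x", OF _ _ smear_finite])
      (simp_all add: mode_simps scale_right_distrib mult.commute)
qed

lemma smear_left:
  "smear F A (f + g) n c = smear F A f n c + smear F A g n c"
  "smear F A (smult F x f) n c = smult F x (smear F A f n c)"
  "smear F A 0 n c = 0"
proof -
  show z: "smear F A 0 n c = 0" by (simp add: smear_def mode_zero)
  show "smear F A (f + g) n c = smear F A f n c + smear F A g n c"
    by (simp add: smear_def mode_simps scale_right_distrib
        Sum_any.distrib[OF smear_finite smear_finite])
  show "smear F A (smult F x f) n c = smult F x (smear F A f n c)"
    unfolding smear_def
    by (subst additive_Sum_any[where h = "smult F x", OF _ _ smear_finite])
      (simp_all add: mode_simps scale_right_distrib mult.commute)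
qed

lemma smear_series:
  "smear F (A + B) f n c = smear F A f n c + smear F B f n c"
  "smear F (fls_const x * A) f n c = smult F x (smear F A f n c)"
  "smear F 0 f n c = 0"
proof -
  show z: "smear F 0 f n c = 0" by (simp add: smear_def)
  show "smear F (A + B) f n c = smear F A f n c + smear F B f n c"
    by (simp add: smear_def scale_left_distrib
        Sum_any.distrib[OF smear_finite smear_finite])
  show "smear F (fls_const x * A) f n c = smult F x (smear F A f n c)"
    unfolding smear_def
    by (subst additive_Sum_any[where h = "smult F x", OF _ _ smear_finite])
      (simp_all add: scale_right_distrib)
qed

lemma smear_sum_right: "smear F A f n (sum h S) = (\<Sum>x\<in>S. smear F A f n (h x))"
  by (induction S rule: infinite_finite_induct) (simp_all add: smear_right)

lemma smear_one: "smear F 1 f n c = mode F f n c"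
  unfolding smear_def by (subst Sum_any_eq_sum[of "{n}"]) auto

lemma smear_vacuum: "smear F A (vacuum F) n c = smult F (fls_nth A (- 1 - n)) c"
  unfolding smear_def by (subst Sum_any_eq_sum[of "{-1}"]) (auto simp: mode_vacuum)

lemma smear_vanishes:
  assumes "\<forall>k<L. fls_nth A k = 0" "\<forall>k\<ge>N. mode F f k c = 0" "N \<le> n + L"
  shows "smear F A f n c = 0"
  using smear_eq_sum[OF assms] by simp

lemma smear_truncation: "\<exists>N. \<forall>n\<ge>N. smear F A f n c = 0"
proof -
  obtain N where "\<forall>k\<ge>N. mode F f k c = 0" using truncation by blast
  then have "smear F A f n c = 0" if "n \<ge> N - fls_subdegree A" for n
    using that by (intro smear_vanishes[of "fls_subdegree A" A N]) auto
  then show ?thesis by blast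
qed

text \<open>Multiplying fields by Laurent series is an action of the algebra $C((z))$:
  $(A B) Y(f,z) = B (A Y(f,z))$.\<close>

lemma smear_mult:
  "smear F (A * B) f n c = Sum_any (\<lambda>s. smult F (fls_nth B s) (smear F A f (n + s) c))"
proof -
  obtain L where L: "\<forall>k<L. fls_nth A k = 0" "\<forall>k<L. fls_nth B k = 0"
    using fls_lower_bound[of A B] by auto
  obtain N where N: "\<forall>k\<ge>N. mode F f k c = 0" using truncation by blast
  let ?h = "\<lambda>s k. smult F (fls_nth A (k - (n + s)) * fls_nth B s) (mode F f k c)"
  \<comment> \<open>the double family of summands lives in a bounded box, so its sums may be interchanged\<close>
  have bounds: "L \<le> s \<and> n + s + L \<le> k \<and> k < N" if "?h s k \<noteq> 0" for s k
  proof -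
    have "\<not> s < L" "\<not> k - (n + s) < L" "\<not> N \<le> k" using that L N by auto
    then show ?thesis by linarith
  qed
  have "Sum_any (\<lambda>s. smult F (fls_nth B s) (smear F A f (n + s) c)) = Sum_any (\<lambda>s. Sum_any (?h s))"
    unfolding smear_def
    by (subst additive_Sum_any[where h = "smult F _", OF _ _ smear_finite])
      (simp_all add: scale_right_distrib mult.commute)
  also have "\<dots> = Sum_any (\<lambda>k. Sum_any (\<lambda>s. ?h s k))"
  proof (rule Sum_any.swap[where C = "{L..<N - n - L} \<times> {n + L + L..<N}"])
    show "{s. \<exists>k. ?h s k \<noteq> 0} \<times> {k. \<exists>s. ?h s k \<noteq> 0} \<subseteq> {L..<N - n - L} \<times> {n + L + L..<N}"
    proof
      fix x assume "x \<in> {s. \<exists>k. ?h s k \<noteq> 0} \<times> {k. \<exists>s. ?h s k \<noteq> 0}"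
      then obtain s k k' s' where x: "x = (s, k)" "?h s k' \<noteq> 0" "?h s' k \<noteq> 0" by blast
      from bounds[OF x(2)] bounds[OF x(3)]
      show "x \<in> {L..<N - n - L} \<times> {n + L + L..<N}" by (auto simp: x(1))
    qed
  qed simp
  also have "\<dots> = Sum_any (\<lambda>k. smult F (fls_nth (A * B) (k - n)) (mode F f k c))"
    by (subst fls_times_Sum_any(1)[OF L],
        subst additive_Sum_any[where h = "\<lambda>x. smult F x _", OF _ _ fls_times_Sum_any(2)[OF L]])
      (simp_all add: scale_left_distrib diff_diff_eq)
  finally show ?thesis by (simp add: smear_def)
qed

text \<open>The double sum is the expansion of $(\partial^i A / i!)(z) B(z) Y(h,z)$ in the monomials
  $a_r z^r$ of \<open>A\<close> and $b_s z^s$ of \<open>B\<close>.\<close>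

lemma smear_hasse_mult:
  assumes L: "\<forall>k<L. fls_nth A k = 0 \<and> fls_nth B k = 0"
    and N: "\<forall>k\<ge>N. mode F h k c = 0" "N \<le> n - int i + R + L"
  shows "smear F (hasse i A * B) h n c = (\<Sum>r\<in>{L..<R}. \<Sum>s\<in>{L..<R}.
    smult F ((of_int r gchoose i) * fls_nth A r * fls_nth B s) (mode F h (n + r + s - int i) c))"
proof -
  \<comment> \<open>the range of exponents shifts by \<open>i\<close>, as $z^r$ becomes a multiple of $z^{r-i}$\<close>
  have *: "smear F (hasse i A) h (n + s) c = (\<Sum>r\<in>{L..<R}.
      smult F ((of_int r gchoose i) * fls_nth A r) (mode F h (n + r + s - int i) c))"
    if "s \<ge> L" for s
  proof -
    have "smear F (hasse i A) h (n + s) c = (\<Sum>t\<in>{L - int i..<R - int i}.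
      smult F (fls_nth (hasse i A) t) (mode F h (n + s + t) c))"
      by (rule smear_eq_sum[OF _ N(1)]) (use L N(2) that in \<open>auto simp: fls_nth_hasse\<close>)
    also have "\<dots> = (\<Sum>r\<in>{L..<R}.
      smult F ((of_int r gchoose i) * fls_nth A r) (mode F h (n + r + s - int i) c))"
      by (rule sum.reindex_bij_witness[of _ "\<lambda>r. r - int i" "\<lambda>t. t + int i"])
        (auto simp: fls_nth_hasse algebra_simps)
    finally show ?thesis .
  qed
  have "smear F (hasse i A * B) h n c
      = (\<Sum>s\<in>{L..<R}. smult F (fls_nth B s) (smear F (hasse i A) h (n + s) c))"
    unfolding smear_mult
  proof (rule Sum_any_eq_sum)
    fix s assume "s \<notin> {L..<R}"
    then consider "s < L" | "L \<le> s" "R \<le> s" by force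
    then show "smult F (fls_nth B s) (smear F (hasse i A) h (n + s) c) = 0"
    proof cases
      case 1
      then show ?thesis using L by simp
    next
      case 2
      then have "mode F h (n + r + s - int i) c = 0" if "r \<in> {L..<R}" for r
        using that N by simp
      then have "smear F (hasse i A) h (n + s) c = 0"
        unfolding *[OF 2(1)] by (intro sum.neutral) simp
      then show ?thesis by simp
    qed
  qed simp
  also have "\<dots> = (\<Sum>s\<in>{L..<R}. \<Sum>r\<in>{L..<R}.
      smult F ((of_int r gchoose i) * fls_nth A r * fls_nth B s) (mode F h (n + r + s - int i) c))"
    by (intro sum.cong refl) (simp add: * scale_sum_right mult_ac)
  finally show ?thesis by (subst sum.swap)
qed

text \<open>Vandermonde's identity for a sequence \<open>v\<close> that vanishes from \<open>K\<close> on: outside the triangle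
  $j + i < K$ the summands of the square are zero.\<close>

lemma vandermonde_sum:
  assumes "\<And>k. k \<ge> K \<Longrightarrow> v k = 0"
  shows "(\<Sum>j<K. \<Sum>i<K. smult F ((x gchoose j) * (y gchoose i)) (v (j + i)))
    = (\<Sum>k<K. smult F ((x + y) gchoose k) (v k))"
proof -
  let ?g = "\<lambda>j i. smult F ((x gchoose j) * (y gchoose i)) (v (j + i))"
  have "(\<Sum>j<K. \<Sum>i<K. ?g j i) = (\<Sum>(j, i)\<in>{..<K} \<times> {..<K}. ?g j i)"
    by (rule sum.cartesian_product)
  also have "\<dots> = (\<Sum>(j, i)\<in>{(j, i). j + i < K}. ?g j i)"
  proof (rule sum.mono_neutral_right)
    show "\<forall>x\<in>{..<K} \<times> {..<K} - {(j, i). j + i < K}. (case x of (j, i) \<Rightarrow> ?g j i) = 0"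
      by (simp add: split_def assms not_less)
  qed auto
  also have "\<dots> = (\<Sum>k<K. \<Sum>j\<le>k. ?g j (k - j))" by (rule sum.triangle_reindex)
  also have "\<dots> = (\<Sum>k<K. smult F ((x + y) gchoose k) (v k))"
    by (intro sum.cong refl)
      (simp add: gbinomial_Vandermonde[symmetric] scale_sum_left atMost_atLeast0)
  finally show ?thesis .
qed

end

section \<open>The Borcherds identity for smeared fields\<close>

context vertex_algebra begin

lemma borcherds:
  assumes "a \<in> part F p" "b \<in> part F q"
  shows "(\<Sum>j::nat. smult F (of_int m gchoose j) (mode F (mode F a (l + int j) b) (m + n - int j) c))
    = (\<Sum>j::nat. smult F ((-1) ^ j * (of_int l gchoose j))
        (mode F a (m + l - int j) (mode F b (n + int j) c)
          - smult F (koszul p q * (-1) powi l) (mode F b (n + l - int j) (mode F a (m + int j) c))))"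
  using vertex_action assms unfolding vertex_action_def borcherds_identity_def by blast

text \<open>The left-hand side of the Borcherds identity for the fields $A(z) Y(f,z)$ and $B(z) Y(g,z)$,
  where the composite field is $A(z + x) B(z) Y(Y(f,x) g,z)$.  The monomials $z^r$, $z^s$ of
  \<open>A\<close>, \<open>B\<close> contribute ${m \choose j} {r \choose i}$ times a vector that depends only on
  $i + j$; Vandermonde's identity combines the two factors into the coefficient
  ${m + r \choose i + j}$ of the identity of \<open>F\<close> for the indices $l$, $m + r$, $n + s$.
  The bound \<open>R0\<close> makes it possible to use the same range of exponents as on the other side.\<close>

lemma smear_borcherds_left:
  fixes l m n :: int and f g c :: 'f
  assumes L: "\<forall>k<L. fls_nth A k = 0 \<and> fls_nth B k = 0"
  defines "t \<equiv> \<lambda>j::nat. smult F (of_int m gchoose j)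
      (\<Sum>i::nat. smear F (hasse i A * B) (mode F f (l + int j + int i) g) (m + n - int j) c)"
  shows "finite {j. t j \<noteq> 0}"
    and "\<exists>R0. \<forall>R\<ge>R0. Sum_any t = (\<Sum>r\<in>{L..<R}. \<Sum>s\<in>{L..<R}. smult F (fls_nth A r * fls_nth B s)
      (\<Sum>j::nat. smult F (of_int (m + r) gchoose j)
        (mode F (mode F f (l + int j) g) (m + r + (n + s) - int j) c)))"
proof -
  let ?v = "\<lambda>k::nat. mode F f (l + int k) g"
  obtain K0 where K0: "\<forall>k\<ge>K0. mode F f k g = 0" using truncation by blast
  \<comment> \<open>from \<open>K\<close> on, all products of \<open>f\<close> and \<open>g\<close> in the sum vanish\<close>
  define K where "K = nat (K0 - l)"
  have K: "?v k = 0" if "k \<ge> K" for k using that K0 by (simp add: K_def)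
  have fg: "mode F f (l + int j + int i) g = ?v (j + i)" for i j by (simp add: add.assoc)
  have inner: "(\<Sum>i::nat. smear F (hasse i A * B) (?v (j + i)) N c)
      = (\<Sum>i<K. smear F (hasse i A * B) (?v (j + i)) N c)" for j N
    by (rule Sum_any_eq_sum) (simp_all only: lessThan_iff not_less K trans_le_add2 smear_left
        finite_lessThan)
  have t: "t j = smult F (of_int m gchoose j)
      (\<Sum>i<K. smear F (hasse i A * B) (?v (j + i)) (m + n - int j) c)" for j
    unfolding t_def fg inner ..
  have t0: "t j = 0" if "j \<ge> K" for j
    unfolding t using that
    by (simp only: K trans_le_add1 smear_left sum.neutral_const scale_zero_right)
  then have "{j. t j \<noteq> 0} \<subseteq> {..<K}" by (auto simp: not_le[symmetric])
  then show "finite {j. t j \<noteq> 0}" by (rule finite_subset) simp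
  obtain N where N': "\<forall>k\<ge>N. \<forall>(f, c)\<in>(\<lambda>k. (?v k, c)) ` {..<K}. mode F f k c = 0"
    using uniform_truncation[of "(\<lambda>k. (?v k, c)) ` {..<K}"] by auto
  have N: "\<forall>k'\<ge>N. mode F (?v k) k' c = 0" for k
    using N' K[of k] by (cases "k < K") (auto simp: mode_zero)
  show "\<exists>R0. \<forall>R\<ge>R0. Sum_any t = (\<Sum>r\<in>{L..<R}. \<Sum>s\<in>{L..<R}. smult F (fls_nth A r * fls_nth B s)
      (\<Sum>j::nat. smult F (of_int (m + r) gchoose j)
        (mode F (mode F f (l + int j) g) (m + r + (n + s) - int j) c)))"
  proof (intro exI[of _ "N - L - m - n + 2 * int K"] allI impI)
    fix R assume R: "N - L - m - n + 2 * int K \<le> R"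
    let ?S = "{L..<R}"
    let ?w = "\<lambda>r s k::nat. mode F (?v k) (m + r + (n + s) - int k) c"
    \<comment> \<open>the bound on \<open>R\<close> is used here: the largest value of $i + j$ is below $2 K$\<close>
    have sm: "smear F (hasse i A * B) (?v (j + i)) (m + n - int j) c = (\<Sum>r\<in>?S. \<Sum>s\<in>?S.
        smult F ((of_int r gchoose i) * fls_nth A r * fls_nth B s) (?w r s (j + i)))"
      if "i < K" "j < K" for i j
      by (subst smear_hasse_mult[OF L N]) (use that R in \<open>auto simp: algebra_simps\<close>)
    have "Sum_any t = (\<Sum>j<K. t j)"
      by (rule Sum_any_eq_sum) (simp_all add: t0)
    also have "\<dots> = (\<Sum>j<K. \<Sum>i<K. \<Sum>r\<in>?S. \<Sum>s\<in>?S. smult F (fls_nth A r * fls_nth B s)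
        (smult F ((of_int m gchoose j) * (of_int r gchoose i)) (?w r s (j + i))))"
    proof (rule sum.cong[OF refl])
      fix j assume j: "j \<in> {..<K}"
      have "(\<Sum>i<K. smear F (hasse i A * B) (?v (j + i)) (m + n - int j) c)
          = (\<Sum>i<K. \<Sum>r\<in>?S. \<Sum>s\<in>?S.
            smult F ((of_int r gchoose i) * fls_nth A r * fls_nth B s) (?w r s (j + i)))"
        by (intro sum.cong refl sm) (use j in auto)
      then show "t j = (\<Sum>i<K. \<Sum>r\<in>?S. \<Sum>s\<in>?S. smult F (fls_nth A r * fls_nth B s)
          (smult F ((of_int m gchoose j) * (of_int r gchoose i)) (?w r s (j + i))))"
        unfolding t by (simp only: scale_sum_right scale_scale mult_ac)
    qed
    also have "\<dots> = (\<Sum>j<K. \<Sum>r\<in>?S. \<Sum>s\<in>?S. \<Sum>i<K. smult F (fls_nth A r * fls_nth B s)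
        (smult F ((of_int m gchoose j) * (of_int r gchoose i)) (?w r s (j + i))))"
      by (rule sum.cong[OF refl], subst sum.swap, rule sum.cong[OF refl], rule sum.swap)
    also have "\<dots> = (\<Sum>r\<in>?S. \<Sum>s\<in>?S. \<Sum>j<K. \<Sum>i<K. smult F (fls_nth A r * fls_nth B s)
        (smult F ((of_int m gchoose j) * (of_int r gchoose i)) (?w r s (j + i))))"
      by (subst sum.swap, rule sum.cong[OF refl], rule sum.swap)
    also have "\<dots> = (\<Sum>r\<in>?S. \<Sum>s\<in>?S. smult F (fls_nth A r * fls_nth B s)
        (\<Sum>k<K. smult F (of_int (m + r) gchoose k) (?w r s k)))"
    proof (intro sum.cong refl)
      fix r s
      have "?w r s k = 0" if "k \<ge> K" for k using K[OF that] by (simp add: mode_zero)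
      from vandermonde_sum[of K "?w r s" "of_int m" "of_int r", OF this]
      show "(\<Sum>j<K. \<Sum>i<K. smult F (fls_nth A r * fls_nth B s)
          (smult F ((of_int m gchoose j) * (of_int r gchoose i)) (?w r s (j + i))))
        = smult F (fls_nth A r * fls_nth B s)
          (\<Sum>k<K. smult F (of_int (m + r) gchoose k) (?w r s k))"
        by (simp only: scale_sum_right[symmetric] of_int_add)
    qed
    also have "\<dots> = (\<Sum>r\<in>?S. \<Sum>s\<in>?S. smult F (fls_nth A r * fls_nth B s)
        (\<Sum>k::nat. smult F (of_int (m + r) gchoose k) (?w r s k)))"
    proof (intro sum.cong refl arg_cong[where f = "smult F _"])
      fix r s
      show "(\<Sum>k<K. smult F (of_int (m + r) gchoose k) (?w r s k))
          = (\<Sum>k::nat. smult F (of_int (m + r) gchoose k) (?w r s k))"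
        by (rule Sum_any_eq_sum[symmetric]) (simp_all add: K mode_zero)
    qed
    finally show "Sum_any t = (\<Sum>r\<in>?S. \<Sum>s\<in>?S. smult F (fls_nth A r * fls_nth B s)
        (\<Sum>k::nat. smult F (of_int (m + r) gchoose k) (?w r s k)))" .
  qed
qed

lemma smear_smear:
  assumes L: "\<forall>k<L. fls_nth A k = 0 \<and> fls_nth B k = 0"
    and N: "\<forall>k\<ge>N. mode F g k c = 0" "N \<le> n' + R"
    and K: "\<forall>k\<ge>K. \<forall>t\<ge>n' + L. mode F f k (mode F g t c) = 0" "K \<le> n + R"
  shows "smear F A f n (smear F B g n' c) = (\<Sum>r\<in>{L..<R}. \<Sum>s\<in>{L..<R}.
    smult F (fls_nth A r * fls_nth B s) (mode F f (n + r) (mode F g (n' + s) c)))"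
proof -
  have "smear F B g n' c = (\<Sum>s\<in>{L..<R}. smult F (fls_nth B s) (mode F g (n' + s) c))"
    by (rule smear_eq_sum[OF _ N]) (use L in simp)
  then have "smear F A f n (smear F B g n' c)
      = (\<Sum>s\<in>{L..<R}. smult F (fls_nth B s) (smear F A f n (mode F g (n' + s) c)))"
    by (simp add: smear_sum_right smear_right)
  also have "\<dots> = (\<Sum>s\<in>{L..<R}. smult F (fls_nth B s)
      (\<Sum>r\<in>{L..<R}. smult F (fls_nth A r) (mode F f (n + r) (mode F g (n' + s) c))))"
    by (intro sum.cong refl arg_cong[where f = "smult F _"] smear_eq_sum[OF _ _ K(2)])
      (use L K(1) in auto)
  also have "\<dots> = (\<Sum>s\<in>{L..<R}. \<Sum>r\<in>{L..<R}.
    smult F (fls_nth A r * fls_nth B s) (mode F f (n + r) (mode F g (n' + s) c)))"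
    by (simp add: scale_sum_right mult.commute)
  finally show ?thesis by (subst sum.swap)
qed

text \<open>The right-hand side, likewise.  The sum over \<open>j\<close> is finite because \<open>j\<close> is added to the index
  of the operator that acts first.  Once \<open>j\<close> is bounded, so are the exponents that contribute
  through the operator that acts last, although its index has \<open>j\<close> subtracted.  The scalar \<open>x\<close>
  stands for the sign of the identity.\<close>

lemma smear_borcherds_right:
  fixes l m n :: int and f g c :: 'f and x :: complex
  assumes L: "\<forall>k<L. fls_nth A k = 0 \<and> fls_nth B k = 0"
  defines "t \<equiv> \<lambda>j::nat. smult F ((-1) ^ j * (of_int l gchoose j))
      (smear F A f (m + l - int j) (smear F B g (n + int j) c)
        - smult F x (smear F B g (n + l - int j) (smear F A f (m + int j) c)))"
  shows "finite {j. t j \<noteq> 0}"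
    and "\<exists>R0. \<forall>R\<ge>R0. Sum_any t = (\<Sum>r\<in>{L..<R}. \<Sum>s\<in>{L..<R}. smult F (fls_nth A r * fls_nth B s)
      (\<Sum>j::nat. smult F ((-1) ^ j * (of_int l gchoose j))
        (mode F f (m + r + l - int j) (mode F g (n + s + int j) c)
          - smult F x (mode F g (n + s + l - int j) (mode F f (m + r + int j) c)))))"
proof -
  obtain N where N: "\<forall>k\<ge>N. \<forall>(h, c)\<in>{(f, c), (g, c)}. mode F h k c = 0"
    using uniform_truncation[of "{(f, c), (g, c)}"] by auto
  then have Nf: "\<forall>k\<ge>N. mode F f k c = 0" and Ng: "\<forall>k\<ge>N. mode F g k c = 0" by auto
  \<comment> \<open>from \<open>J\<close> on, the operator that acts first gives zero, for every exponent $\ge L$\<close>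
  define J where "J = nat (max (N - n - L) (N - m - L))"
  have z: "smear F B g (n + int j) c = 0" "smear F A f (m + int j) c = 0" if "j \<ge> J" for j
    using that L by (auto simp: J_def intro: smear_vanishes[OF _ Ng, of L] smear_vanishes[OF _ Nf, of L])
  have t0: "t j = 0" if "j \<ge> J" for j
    using z[OF that] by (simp add: t_def smear_right)
  then have "{j. t j \<noteq> 0} \<subseteq> {..<J}" by (auto simp: not_le[symmetric])
  then show "finite {j. t j \<noteq> 0}" by (rule finite_subset) simp
  obtain K1 where K1: "\<forall>k\<ge>K1. \<forall>t\<ge>n + L. mode F f k (mode F g t c) = 0"
    using truncation_above[OF Ng] by blast
  obtain K2 where K2: "\<forall>k\<ge>K2. \<forall>t\<ge>m + L. mode F g k (mode F f t c) = 0"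
    using truncation_above[OF Nf] by blast
  define R0 where "R0 = Max {N - n, N - m, K1 - (m + l) + int J, K2 - (n + l) + int J}"
  show "\<exists>R0. \<forall>R\<ge>R0. Sum_any t = (\<Sum>r\<in>{L..<R}. \<Sum>s\<in>{L..<R}. smult F (fls_nth A r * fls_nth B s)
      (\<Sum>j::nat. smult F ((-1) ^ j * (of_int l gchoose j))
        (mode F f (m + r + l - int j) (mode F g (n + s + int j) c)
          - smult F x (mode F g (n + s + l - int j) (mode F f (m + r + int j) c)))))"
  proof (intro exI[of _ R0] allI impI)
    fix R assume "R0 \<le> R"
    then have R: "N - n \<le> R" "N - m \<le> R" "K1 - (m + l) + int J \<le> R" "K2 - (n + l) + int J \<le> R"
      by (simp_all add: R0_def)
    let ?S = "{L..<R}"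
    let ?u = "\<lambda>r s j::nat. smult F ((-1) ^ j * (of_int l gchoose j))
        (mode F f (m + r + l - int j) (mode F g (n + s + int j) c)
          - smult F x (mode F g (n + s + l - int j) (mode F f (m + r + int j) c)))"
    have tj: "t j = (\<Sum>r\<in>?S. \<Sum>s\<in>?S. smult F (fls_nth A r * fls_nth B s) (?u r s j))" if "j < J" for j
    proof -
      have "smear F A f (m + l - int j) (smear F B g (n + int j) c) = (\<Sum>r\<in>?S. \<Sum>s\<in>?S.
          smult F (fls_nth A r * fls_nth B s) (mode F f (m + r + l - int j) (mode F g (n + s + int j) c)))"
        by (subst smear_smear[of L _ _ N _ _ _ R K1])
          (use that L Ng K1 R in \<open>auto simp: algebra_simps\<close>)
      moreover have "smear F B g (n + l - int j) (smear F A f (m + int j) c) = (\<Sum>r\<in>?S. \<Sum>s\<in>?S.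
          smult F (fls_nth A r * fls_nth B s) (mode F g (n + s + l - int j) (mode F f (m + r + int j) c)))"
        by (subst smear_smear[of L _ _ N _ _ _ R K2], (use that L Nf K2 R in \<open>auto simp: algebra_simps\<close>)[5],
            subst sum.swap) (simp add: algebra_simps)
      ultimately show ?thesis
        by (simp add: t_def scale_sum_right scale_right_diff_distrib sum_subtractf mult_ac)
    qed
    have "Sum_any t = (\<Sum>j<J. t j)"
      by (rule Sum_any_eq_sum) (simp_all add: t0)
    also have "\<dots> = (\<Sum>j<J. \<Sum>r\<in>?S. \<Sum>s\<in>?S. smult F (fls_nth A r * fls_nth B s) (?u r s j))"
      by (simp add: tj)
    also have "\<dots> = (\<Sum>r\<in>?S. \<Sum>s\<in>?S. \<Sum>j<J. smult F (fls_nth A r * fls_nth B s) (?u r s j))"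
      by (subst sum.swap, rule sum.cong[OF refl], rule sum.swap)
    also have "\<dots> = (\<Sum>r\<in>?S. \<Sum>s\<in>?S. smult F (fls_nth A r * fls_nth B s) (\<Sum>j<J. ?u r s j))"
      by (simp only: scale_sum_right)
    also have "\<dots> = (\<Sum>r\<in>?S. \<Sum>s\<in>?S. smult F (fls_nth A r * fls_nth B s) (Sum_any (?u r s)))"
    proof (intro sum.cong refl arg_cong[where f = "smult F _"])
      fix r s assume "r \<in> ?S" "s \<in> ?S"
      then have "?u r s j = 0" if "j \<ge> J" for j
      proof -
        have "N \<le> n + s + int j" "N \<le> m + r + int j"
          using that \<open>r \<in> ?S\<close> \<open>s \<in> ?S\<close> by (auto simp: J_def)
        then show ?thesis using Nf Ng by (simp add: mode_zero)
      qed
      then show "(\<Sum>j<J. ?u r s j) = Sum_any (?u r s)"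
        by (intro Sum_any_eq_sum[symmetric]) simp_all
    qed
    finally show "Sum_any t
      = (\<Sum>r\<in>?S. \<Sum>s\<in>?S. smult F (fls_nth A r * fls_nth B s) (Sum_any (?u r s)))" .
  qed
qed

text \<open>Both sides are the same combination, with coefficients $a_r b_s$, of the two sides of the
  identity of \<open>F\<close> for the indices $l$, $m + r$, $n + s$.\<close>

lemma smear_borcherds:
  assumes "f \<in> part F p" "g \<in> part F q"
  shows "(\<Sum>j::nat. smult F (of_int m gchoose j)
      (\<Sum>i::nat. smear F (hasse i A * B) (mode F f (l + int j + int i) g) (m + n - int j) c))
    = (\<Sum>j::nat. smult F ((-1) ^ j * (of_int l gchoose j))
        (smear F A f (m + l - int j) (smear F B g (n + int j) c)
          - smult F (koszul p q * (-1) powi l)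
              (smear F B g (n + l - int j) (smear F A f (m + int j) c))))"
proof -
  obtain L where L: "\<forall>k<L. fls_nth A k = 0 \<and> fls_nth B k = 0" using fls_lower_bound by blast
  from smear_borcherds_left(2)[OF L] obtain R1 where
    "\<forall>R\<ge>R1. (\<Sum>j::nat. smult F (of_int m gchoose j)
      (\<Sum>i::nat. smear F (hasse i A * B) (mode F f (l + int j + int i) g) (m + n - int j) c))
    = (\<Sum>r\<in>{L..<R}. \<Sum>s\<in>{L..<R}. smult F (fls_nth A r * fls_nth B s)
      (\<Sum>j::nat. smult F (of_int (m + r) gchoose j)
        (mode F (mode F f (l + int j) g) (m + r + (n + s) - int j) c)))" by blast
  moreover from smear_borcherds_right(2)[OF L] obtain R2 where
    "\<forall>R\<ge>R2. (\<Sum>j::nat. smult F ((-1) ^ j * (of_int l gchoose j))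
        (smear F A f (m + l - int j) (smear F B g (n + int j) c)
          - smult F (koszul p q * (-1) powi l)
              (smear F B g (n + l - int j) (smear F A f (m + int j) c))))
    = (\<Sum>r\<in>{L..<R}. \<Sum>s\<in>{L..<R}. smult F (fls_nth A r * fls_nth B s)
      (\<Sum>j::nat. smult F ((-1) ^ j * (of_int l gchoose j))
        (mode F f (m + r + l - int j) (mode F g (n + s + int j) c)
          - smult F (koszul p q * (-1) powi l)
              (mode F g (n + s + l - int j) (mode F f (m + r + int j) c)))))" by blast
  moreover have "R1 \<le> max R1 R2" "R2 \<le> max R1 R2" by simp_all
  ultimately show ?thesis
    by (simp only: borcherds[OF assms])
qed

end

section \<open>The module $F \otimes M(\chi^+,\chi^-)$\<close>

context vertex_algebra begin

lemma subspace_part: "subspace (part F p)"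
  using vertex_action by (simp add: vertex_action_def superspace_def)

lemma mode_part: "f \<in> part F p \<Longrightarrow> c \<in> part F q \<Longrightarrow> mode F f n c \<in> part F (p + q)"
  using vertex_action by (simp add: vertex_action_def)

lemma subspace_Sum_any: "subspace U \<Longrightarrow> (\<And>x. h x \<in> U) \<Longrightarrow> Sum_any h \<in> U"
  unfolding Sum_any.expand_set by (rule subspace_sum)

lemma smear_part: "f \<in> part F p \<Longrightarrow> c \<in> part F q \<Longrightarrow> smear F A f n c \<in> part F (p + q)"
  unfolding smear_def
  by (intro subspace_Sum_any subspace_part subspace_scale[OF subspace_part] mode_part)

text \<open>As $C((z))$ is a field, $Y(f,z) = A(z)^{-1} (A(z) Y(f,z))$, and each mode of \<open>f\<close> on \<open>c\<close> is a
  finite combination of the vectors in the assumption.\<close>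

lemma mode_in_smear_invariant_subspace:
  assumes "subspace U" "A \<noteq> 0" "\<And>n. smear F A f n c \<in> U"
  shows "mode F f n c \<in> U"
proof -
  have "mode F f n c = smear F (A * inverse A) f n c"
    using assms(2) by (simp add: smear_one)
  also have "\<dots> \<in> U"
    unfolding smear_mult by (intro subspace_Sum_any subspace_scale assms)
  finally show ?thesis .
qed

lemma lookup_tens: "Poly_Mapping.lookup (tens F f p) \<mu> = smult F (Poly_Mapping.lookup p \<mu>) f"
  by (simp add: tens_def Poly_Mapping.map.rep_eq when_def)

lemma lookup_smult_FM:
  "Poly_Mapping.lookup (smult (FM_vsa F) x u) \<mu> = smult F x (Poly_Mapping.lookup u \<mu>)"
  by (simp add: FM_vsa_def Poly_Mapping.map.rep_eq when_def)

lemma vector_space_FM: "vector_space (smult (FM_vsa F))"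
  unfolding vector_space_def
  by (intro conjI allI; rule poly_mapping_eqI)
    (simp_all add: lookup_smult_FM lookup_add scale_right_distrib scale_left_distrib)

end

lemma Mchi_field_simps:
  "Mchi_field \<chi> 0 = 0" "Mchi_field \<chi> 1 = 1"
  "Mchi_field \<chi> (p + q) = Mchi_field \<chi> p + Mchi_field \<chi> q"
  "Mchi_field \<chi> (p * q) = Mchi_field \<chi> p * Mchi_field \<chi> q"
  by (simp_all add: Mchi_field_def const_fls.mpol_subst_zero const_fls.mpol_subst_one
      const_fls.mpol_subst_add const_fls.mpol_subst_mult)

lemma Mchi_field_monom_expansion:
  "Mchi_field \<chi> p = (\<Sum>\<mu>\<in>Poly_Mapping.keys p.
    fls_const (Poly_Mapping.lookup p \<mu>) * Mchi_field \<chi> (monom \<mu>))"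
  by (simp add: Mchi_field_def mpol_subst_eq[of _ _ p] monom_def const_fls.mpol_subst_single)

lemma mode_M_vsa_monom:
  "mode M_vsa (monom \<mu>) (N - k - 1) q
    = (if N \<le> k then fps_nth (M_field (monom \<mu>)) (nat (k - N)) * q else 0)"
  by (simp add: M_vsa_def)

definition chi_pair :: "complex fls \<Rightarrow> complex fls \<Rightarrow> pm \<Rightarrow> complex fls" where
  "chi_pair \<chi>p \<chi>m e = (case e of Plus \<Rightarrow> \<chi>p | Minus \<Rightarrow> \<chi>m)"

locale twisted_action = vertex_algebra +
  fixes \<chi>p \<chi>m :: "complex fls"
begin

abbreviation series :: "mpol \<Rightarrow> complex fls" where
  "series \<equiv> Mchi_field (chi_pair \<chi>p \<chi>m)"

abbreviation act :: "'a FM \<Rightarrow> int \<Rightarrow> 'a \<Rightarrow> 'a" where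
  "act \<equiv> mact (FMchi F \<chi>p \<chi>m)"

lemma act_eq:
  "act u n c = (\<Sum>\<mu>\<in>Poly_Mapping.keys u.
    smear F (series (monom \<mu>)) (Poly_Mapping.lookup u \<mu>) n c)"
proof -
  have "(\<lambda>e. case e of Plus \<Rightarrow> \<chi>p | Minus \<Rightarrow> \<chi>m) = chi_pair \<chi>p \<chi>m"
    by (simp add: fun_eq_iff chi_pair_def)
  then show ?thesis by (simp add: FMchi_def Mchi_def smear_def)
qed

lemma act_superset:
  assumes "finite S" "Poly_Mapping.keys u \<subseteq> S"
  shows "act u n c = (\<Sum>\<mu>\<in>S. smear F (series (monom \<mu>)) (Poly_Mapping.lookup u \<mu>) n c)"
  unfolding act_eq
  by (rule sum.mono_neutral_left) (use assms in \<open>auto simp: in_keys_iff smear_left\<close>)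

lemma act_left:
  "act 0 n c = 0" "act (u + w) n c = act u n c + act w n c"
  "act (smult (FM_vsa F) x u) n c = smult F x (act u n c)"
proof -
  show "act 0 n c = 0" by (simp add: act_eq)
  show "act (u + w) n c = act u n c + act w n c"
    unfolding act_eq by (rule setsum_keys_plus_distrib) (simp_all add: smear_left)
  have "Poly_Mapping.keys (smult (FM_vsa F) x u) \<subseteq> Poly_Mapping.keys u"
    by (auto simp: in_keys_iff lookup_smult_FM)
  then show "act (smult (FM_vsa F) x u) n c = smult F x (act u n c)"
    by (simp add: act_superset[of "Poly_Mapping.keys u"] lookup_smult_FM smear_left scale_sum_right)
qed

lemma act_right:
  "act u n (c + d) = act u n c + act u n d" "act u n (smult F x c) = smult F x (act u n c)"
  by (simp_all add: act_eq smear_right sum.distrib scale_sum_right)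

lemma act_sum_left: "act (sum h S) n c = (\<Sum>x\<in>S. act (h x) n c)"
  by (induction S rule: infinite_finite_induct) (simp_all add: act_left)

text \<open>$f \otimes p$ acts as the field of \<open>f\<close>, multiplied by the Laurent series by which \<open>p\<close> acts on
  $M(\chi^+,\chi^-)$.\<close>

lemma act_tens: "act (tens F f p) n c = smear F (series p) f n c"
proof -
  have sum: "smear F (sum B S) f n c = (\<Sum>x\<in>S. smear F (B x) f n c)" for B :: "mono \<Rightarrow> _" and S
    by (induction S rule: infinite_finite_induct) (simp_all add: smear_series)
  have "Poly_Mapping.keys (tens F f p) \<subseteq> Poly_Mapping.keys p"
    by (auto simp: in_keys_iff lookup_tens)
  then have "act (tens F f p) n c = (\<Sum>\<mu>\<in>Poly_Mapping.keys p.
      smult F (Poly_Mapping.lookup p \<mu>) (smear F (series (monom \<mu>)) f n c))"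
    by (simp add: act_superset[of "Poly_Mapping.keys p"] lookup_tens smear_left)
  also have "\<dots> = smear F (series p) f n c"
    by (subst Mchi_field_monom_expansion[of _ p]) (simp only: sum smear_series)
  finally show ?thesis .
qed

text \<open>The mode of a monomial $\mu$ of \<open>M\<close> is zero for nonnegative indices, so the sum over modes
  starts at \<open>N\<close>; its \<open>i\<close>-th term is multiplication by the coefficient of $x^i$ in the
  field of $\mu$, which acts on $M(\chi^+,\chi^-)$ as the \<open>i\<close>-th divided derivative.\<close>

lemma act_mode:
  "act (mode (FM_vsa F) u N w) n c = (\<Sum>\<mu>\<in>Poly_Mapping.keys u. \<Sum>\<nu>\<in>Poly_Mapping.keys w.
    \<Sum>i::nat. smear F (hasse i (series (monom \<mu>)) * series (monom \<nu>))
      (mode F (Poly_Mapping.lookup u \<mu>) (N + int i) (Poly_Mapping.lookup w \<nu>)) n c)"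
proof -
  have "act (Sum_any (\<lambda>k::int. tens F (mode F f k g) (mode M_vsa (monom \<mu>) (N - k - 1) (monom \<nu>)))) n c
      = (\<Sum>i::nat. smear F (hasse i (series (monom \<mu>)) * series (monom \<nu>)) (mode F f (N + int i) g) n c)"
    (is "act (Sum_any ?t) n c = Sum_any ?h") for f g \<mu> \<nu>
  proof -
    obtain K where "\<forall>k\<ge>K. mode F f k g = 0" using truncation by blast
    moreover have "tens F 0 p = 0" "tens F f 0 = 0" for f p
      by (rule poly_mapping_eqI, simp add: lookup_tens)+
    ultimately have "N \<le> k \<and> k < K" if "?t k \<noteq> 0" for k
      using that by (metis mode_M_vsa_monom not_le)
    then have fin: "finite {k. ?t k \<noteq> 0}"
      by (intro finite_int_bounds[of _ N K]) simp
    have "act (Sum_any ?t) n c = Sum_any (\<lambda>k. act (?t k) n c)"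
      by (rule additive_Sum_any[where h = "\<lambda>u. act u n c", OF _ _ fin]) (simp_all add: act_left)
    also have "\<dots> = Sum_any (\<lambda>k. if N \<le> k then ?h (nat (k - N)) else 0)"
      by (rule Sum_any.cong)
        (simp add: act_tens mode_M_vsa_monom Mchi_field_simps Mchi_field_coeff_M_field smear_series)
    also have "\<dots> = Sum_any ?h" by (rule Sum_any_nat_shift)
    finally show ?thesis .
  qed
  then show ?thesis by (simp add: FM_vsa_def act_sum_left)
qed

lemma act_truncation: "\<exists>N. \<forall>n\<ge>N. act u n c = 0"
proof -
  have "\<exists>N. \<forall>n\<ge>N. \<forall>\<mu>\<in>S. smear F (series (monom \<mu>)) (Poly_Mapping.lookup u \<mu>) n c = 0"
    if "finite S" for S
    using that
  proof (induction S rule: finite_induct)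
    case (insert \<mu> S)
    obtain N where "\<forall>n\<ge>N. \<forall>\<mu>\<in>S. smear F (series (monom \<mu>)) (Poly_Mapping.lookup u \<mu>) n c = 0"
      using insert.IH by blast
    moreover obtain M where "\<forall>n\<ge>M. smear F (series (monom \<mu>)) (Poly_Mapping.lookup u \<mu>) n c = 0"
      using smear_truncation by blast
    ultimately show ?case by (intro exI[of _ "max N M"]) simp
  qed simp
  from this[of "Poly_Mapping.keys u"] obtain N where
    "\<forall>n\<ge>N. \<forall>\<mu>\<in>Poly_Mapping.keys u. smear F (series (monom \<mu>)) (Poly_Mapping.lookup u \<mu>) n c = 0"
    by auto
  then show ?thesis by (intro exI[of _ N]) (simp add: act_eq)
qed

text \<open>Both sides are biadditive in \<open>u\<close> and \<open>w\<close>, once the sums over \<open>j\<close> are known to be finite, so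
  the identity reduces to the terms $f \otimes \mu$, $g \otimes \nu$ of \<open>u\<close> and \<open>w\<close>.\<close>

lemma act_borcherds:
  assumes u: "u \<in> part (FM_vsa F) p" and w: "w \<in> part (FM_vsa F) q"
  shows "(\<Sum>j::nat. smult F (of_int m gchoose j)
      (act (mode (FM_vsa F) u (l + int j) w) (m + n - int j) c))
    = (\<Sum>j::nat. smult F ((-1) ^ j * (of_int l gchoose j))
        (act u (m + l - int j) (act w (n + int j) c)
          - smult F (koszul p q * (-1) powi l) (act w (n + l - int j) (act u (m + int j) c))))"
proof -
  let ?f = "Poly_Mapping.lookup u" and ?g = "Poly_Mapping.lookup w"
  let ?A = "\<lambda>\<mu>. series (monom \<mu>)"
  let ?x = "koszul p q * (-1) powi l"
  let ?l = "\<lambda>\<mu> \<nu>. \<lambda>j::nat. smult F (of_int m gchoose j)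
      (\<Sum>i::nat. smear F (hasse i (?A \<mu>) * ?A \<nu>)
        (mode F (?f \<mu>) (l + int j + int i) (?g \<nu>)) (m + n - int j) c)"
  let ?r = "\<lambda>\<mu> \<nu>. \<lambda>j::nat. smult F ((-1) ^ j * (of_int l gchoose j))
      (smear F (?A \<mu>) (?f \<mu>) (m + l - int j) (smear F (?A \<nu>) (?g \<nu>) (n + int j) c)
        - smult F ?x
            (smear F (?A \<nu>) (?g \<nu>) (n + l - int j) (smear F (?A \<mu>) (?f \<mu>) (m + int j) c)))"
  have fin: "finite {j. ?l \<mu> \<nu> j \<noteq> 0}" "finite {j. ?r \<mu> \<nu> j \<noteq> 0}" for \<mu> \<nu>
  proof -
    obtain L where L: "\<forall>k<L. fls_nth (?A \<mu>) k = 0 \<and> fls_nth (?A \<nu>) k = 0"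
      using fls_lower_bound by blast
    show "finite {j. ?l \<mu> \<nu> j \<noteq> 0}" by (rule smear_borcherds_left(1)[OF L])
    show "finite {j. ?r \<mu> \<nu> j \<noteq> 0}" by (rule smear_borcherds_right(1)[OF L])
  qed
  have swap: "Sum_any (\<lambda>j. \<Sum>\<mu>\<in>Poly_Mapping.keys u. \<Sum>\<nu>\<in>Poly_Mapping.keys w. t \<mu> \<nu> j)
      = (\<Sum>\<mu>\<in>Poly_Mapping.keys u. \<Sum>\<nu>\<in>Poly_Mapping.keys w. Sum_any (t \<mu> \<nu>))"
    if t: "\<And>\<mu> \<nu>. finite {j. t \<mu> \<nu> j \<noteq> 0}" for t :: "mono \<Rightarrow> mono \<Rightarrow> nat \<Rightarrow> 'a"
  proof -
    have "finite {j. (\<Sum>\<nu>\<in>Poly_Mapping.keys w. t \<mu> \<nu> j) \<noteq> 0}" for \<mu>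
      by (rule finite_subset[of _ "\<Union>\<nu>\<in>Poly_Mapping.keys w. {j. t \<mu> \<nu> j \<noteq> 0}"])
        (auto simp: t elim!: sum.not_neutral_contains_not_neutral)
    then show ?thesis by (simp add: Sum_any_sum t)
  qed
  have "(\<Sum>j::nat. smult F (of_int m gchoose j)
      (act (mode (FM_vsa F) u (l + int j) w) (m + n - int j) c))
      = Sum_any (\<lambda>j. \<Sum>\<mu>\<in>Poly_Mapping.keys u. \<Sum>\<nu>\<in>Poly_Mapping.keys w. ?l \<mu> \<nu> j)"
    by (simp only: act_mode scale_sum_right)
  also have "\<dots> = (\<Sum>\<mu>\<in>Poly_Mapping.keys u. \<Sum>\<nu>\<in>Poly_Mapping.keys w. Sum_any (?l \<mu> \<nu>))"
    by (rule swap[OF fin(1)])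
  also have "\<dots> = (\<Sum>\<mu>\<in>Poly_Mapping.keys u. \<Sum>\<nu>\<in>Poly_Mapping.keys w. Sum_any (?r \<mu> \<nu>))"
    using u w by (intro sum.cong refl smear_borcherds) (simp_all add: FM_vsa_def)
  also have "\<dots> = Sum_any (\<lambda>j. \<Sum>\<mu>\<in>Poly_Mapping.keys u. \<Sum>\<nu>\<in>Poly_Mapping.keys w. ?r \<mu> \<nu> j)"
    by (rule swap[OF fin(2), symmetric])
  also have "\<dots> = (\<Sum>j::nat. smult F ((-1) ^ j * (of_int l gchoose j))
        (act u (m + l - int j) (act w (n + int j) c)
          - smult F ?x (act w (n + l - int j) (act u (m + int j) c))))"
  proof (rule Sum_any.cong)
    fix j
    have "act w k (act u k' c) = (\<Sum>\<mu>\<in>Poly_Mapping.keys u. \<Sum>\<nu>\<in>Poly_Mapping.keys w.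
        smear F (?A \<nu>) (?g \<nu>) k (smear F (?A \<mu>) (?f \<mu>) k' c))" for k k'
      unfolding act_eq smear_sum_right by (rule sum.swap)
    moreover have "act u k (act w k' c) = (\<Sum>\<mu>\<in>Poly_Mapping.keys u. \<Sum>\<nu>\<in>Poly_Mapping.keys w.
        smear F (?A \<mu>) (?f \<mu>) k (smear F (?A \<nu>) (?g \<nu>) k' c))" for k k'
      unfolding act_eq smear_sum_right ..
    ultimately show "(\<Sum>\<mu>\<in>Poly_Mapping.keys u. \<Sum>\<nu>\<in>Poly_Mapping.keys w. ?r \<mu> \<nu> j)
        = smult F ((-1) ^ j * (of_int l gchoose j))
        (act u (m + l - int j) (act w (n + int j) c)
          - smult F ?x (act w (n + l - int j) (act u (m + int j) c)))"
      by (simp add: scale_sum_right scale_right_diff_distrib sum_subtractf)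
  qed
  finally show ?thesis .
qed

lemma vertex_action_FMchi: "vertex_action (FM_vsa F) (smult F) (part F) act"
  unfolding vertex_action_def
proof (intro conjI allI ballI)
  show "superspace (smult F) (part F)"
    using vertex_action by (simp add: vertex_action_def)
  show "Vector_Spaces.linear (smult F) (smult F) (act u n)" for u n
    by (simp add: Vector_Spaces.linear_iff vector_space_axioms act_right)
  show "Vector_Spaces.linear (smult (FM_vsa F)) (smult F) (\<lambda>u. act u n c)" for n c
    by (simp add: Vector_Spaces.linear_iff vector_space_axioms vector_space_FM act_left)
  show "act u n c \<in> part F (p + q)" if "u \<in> part (FM_vsa F) p" "c \<in> part F q" for p q n u c
    unfolding act_eq
    by (intro subspace_sum subspace_part smear_part) (use that in \<open>simp_all add: FM_vsa_def\<close>)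
  show "\<exists>N. \<forall>n\<ge>N. act u n c = 0" for u c by (rule act_truncation)
  show "act (vacuum (FM_vsa F)) n c = (if n = -1 then c else 0)" for n c
  proof -
    have "vacuum (FM_vsa F) = tens F (vacuum F) 1" by (simp add: FM_vsa_def M_vsa_def)
    then show ?thesis by (auto simp: act_tens Mchi_field_simps smear_vacuum)
  qed
  show "borcherds_identity (FM_vsa F) (smult F) act"
    unfolding borcherds_identity_def by (intro allI ballI act_borcherds)
qed

end

lemma vertex_action_pullback:
  assumes hom: "vsa_hom V U \<phi>" and U: "vertex_action U s P act"
  shows "vertex_action V s P (\<lambda>a. act (\<phi> a))"
proof -
  have lin: "Vector_Spaces.linear (smult V) (smult U) \<phi>"
    and part: "\<And>p a. a \<in> part V p \<Longrightarrow> \<phi> a \<in> part U p"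
    and vac: "\<phi> (vacuum V) = vacuum U"
    and mode: "\<And>a n b. \<phi> (mode V a n b) = mode U (\<phi> a) n (\<phi> b)"
    using hom unfolding vsa_hom_def by blast+
  have "Vector_Spaces.linear (smult V) s (\<lambda>a. act (\<phi> a) n w)" for n w
    using U lin unfolding vertex_action_def
    by (auto simp: Vector_Spaces.linear_iff)
  then show ?thesis
    using U unfolding vertex_action_def borcherds_identity_def vac mode
    by (auto simp: part)
qed

section \<open>Irreducibility\<close>

theorem theorem4p1:
  fixes F :: "'f::ab_group_add vsa" and \<Psi> :: "pm \<Rightarrow> int \<Rightarrow> 'f \<Rightarrow> 'f"
    and V :: "vcri vsa" and \<phi> :: "vcri \<Rightarrow> 'f FM"
    and \<chi>p \<chi>m :: "complex fls"
  assumes "is_clifford_vsa F \<Psi>"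
    and "is_Vcri V"
    and "is_realization F \<Psi> V \<phi>"
    and "\<chi>p \<noteq> 0" and "\<chi>m \<noteq> 0"
  shows "irreducible_module V (F_chi F \<phi> \<chi>p \<chi>m)"
proof -
  have F: "vertex_superalgebra F" and fock: "clifford_fock (smult F) (vacuum F) \<Psi>"
    and mode_\<Psi>: "\<And>e m. mode F (\<Psi> e (-1) (vacuum F)) m = \<Psi> e m"
    using assms(1) by (simp_all add: is_clifford_vsa_def)
  have nonzero: "vacuum F \<noteq> 0"
    and simple: "\<And>U. module.subspace (smult F) U \<and> (\<forall>e m. \<Psi> e m ` U \<subseteq> U) \<Longrightarrow> U = {0} \<or> U = UNIV"
    using fock by (simp_all add: clifford_fock_def)
  interpret twisted_action F \<chi>p \<chi>m by unfold_locales (rule F)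
  have V: "vertex_superalgebra V" using assms(2) by (simp add: is_Vcri_def)
  have hom: "vsa_hom V (FM_vsa F) \<phi>"
    and \<phi>E: "\<phi> (vcri_E Ix1 Ix2) = tens F (\<Psi> Plus (-1) (vacuum F)) (avar Minus 0)"
      "\<phi> (vcri_E Ix2 Ix1) = tens F (\<Psi> Minus (-1) (vacuum F)) (avar Plus 0)"
    using assms(3) by (simp_all add: is_realization_def)
  let ?W = "F_chi F \<phi> \<chi>p \<chi>m"
  have W: "msmult ?W = smult F" "mpart ?W = part F" "mact ?W = (\<lambda>a. act (\<phi> a))"
    by (simp_all add: F_chi_def pullback_def FMchi_def)
  have "vertex_module V ?W"
    unfolding vertex_module_def W
    using V vertex_action_pullback[OF hom vertex_action_FMchi] by simp
  moreover have "\<exists>w::'f. w \<noteq> 0" using nonzero by blast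
  moreover have "U = {0} \<or> U = UNIV" if U: "submodule ?W U" for U
  proof -
    have sub: "subspace U" and inv: "\<And>a n w. w \<in> U \<Longrightarrow> act (\<phi> a) n w \<in> U"
      using U by (simp_all add: submodule_def W)
    have "\<Psi> e n w \<in> U" if "w \<in> U" for e n w
    proof (cases e)
      case Plus
      have "smear F \<chi>m (\<Psi> Plus (-1) (vacuum F)) k w \<in> U" for k
        using inv[OF that, of "vcri_E Ix1 Ix2" k] by (simp add: \<phi>E act_tens Mchi_field_avar chi_pair_def)
      from mode_in_smear_invariant_subspace[OF sub assms(5) this] show ?thesis
        by (simp add: Plus mode_\<Psi>)
    next
      case Minus
      have "smear F \<chi>p (\<Psi> Minus (-1) (vacuum F)) k w \<in> U" for k
        using inv[OF that, of "vcri_E Ix2 Ix1" k] by (simp add: \<phi>E act_tens Mchi_field_avar chi_pair_def)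
      from mode_in_smear_invariant_subspace[OF sub assms(4) this] show ?thesis
        by (simp add: Minus mode_\<Psi>)
    qed
    then have "\<forall>e m. \<Psi> e m ` U \<subseteq> U" by blast
    with sub show ?thesis by (intro simple conjI)
  qed
  ultimately show ?thesis unfolding irreducible_module_def by blast
qed

end
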